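(* Let $F$ be a field of characteristic zero and let $\mathcal{U}=UT_3(F)$ with the elementary $\mathbb{Z}_2$-grading induced by $(0,1,0)$ and the reflection involution. The following polynomials form a basis for the $(\mathbb{Z}_2,\ast)$-identities of $\mathcal{U}$ (here a letter $x_i$ stands for any indeterminate of $Y\cup Z$ subject to the stated restrictions, a letter $z_i$ without superscript stands for any indeterminate of $Z=Z^+\cup Z^-$, and letters with different names stand for distinct indeterminates): (1) $x_1x_2x_3-x_3x_2x_1$, where $x_1,x_3$ both lie in one of the sets $Y^-,Z^+,Z^-$; (2) $z_1z_2z_3$; (3) $[x_1,x_2]$, where $x_1,x_2$ both lie in one of the sets $Y^+,Y^-,Z^+,Z^-$; (4) $[y_1^+,y_2^-][x_3,x_4]$; (5) $[y_1^+,z_1z_2]$; (6) $[y_1^+,y_2^-]z_3$ and $z_3[y_1^+,y_2^-]$; (7) $[y_1^+,y_2^-]y_3^-+y_3^-[y_1^+,y_2^-]$; (8) $y_1^-z_1y_2^-$; (9) $z_1y_1^-z_2$; (10) $z_1^+z_2^-+z_2^-z_1^+$; (11) $z_1z_2y_1^-+y_1^-z_1z_2$.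
   Context: $UT_3(F)$ is the algebra of $3\times3$ upper triangular matrices with elementary matrices $E_{i,j}$. The elementary $\mathbb{Z}_2$-grading induced by $(0,1,0)$ has $\deg E_{i,j}=g_i-g_j$ with $(g_1,g_2,g_3)=(0,1,0)$. The reflection involution is the linear map with $E_{i,j}^\ast=E_{4-j,4-i}$. It preserves the homogeneous components. Let $Y^+=\{y_1^+,y_2^+,\dots\}$, $Y^-=\{y_1^-,y_2^-,\dots\}$, $Z^+=\{z_1^+,z_2^+,\dots\}$, $Z^-=\{z_1^-,z_2^-,\dots\}$ be pairwise disjoint countably infinite sets, $Y=Y^+\cup Y^-$, $Z=Z^+\cup Z^-$. $F\langle Y\cup Z,\ast\rangle$ is the free associative algebra on $Y\cup Z$, with the $\mathbb{Z}_2$-grading in which elements of $Y$ have degree $0$ and elements of $Z$ have degree $1$, and with the involution $\ast$ for which elements of $Y^+\cup Z^+$ are symmetric ($x^\ast=x$) and elements of $Y^-\cup Z^-$ are skew-symmetric ($x^\ast=-x$). It is the free $\mathbb{Z}_2$-graded algebra with graded involution. A polynomial is a $(\mathbb{Z}_2,\ast)$-identity for $\mathcal{U}$ if it vanishes under all substitutions in which indeterminates of $Y^{\pm}$ (resp. $Z^{\pm}$) are replaced by symmetric/skew-symmetric (according to the sign) elements of $\mathcal{U}_0$ (resp. $\mathcal{U}_1$). A set of polynomials is a basis for the $(\mathbb{Z}_2,\ast)$-identities if the smallest two-sided ideal containing it that is invariant under $\ast$ and under all graded endomorphisms commuting with $\ast$ is the ideal of all $(\mathbb{Z}_2,\ast)$-identities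 of $\mathcal{U}$. $[a,b]=ab-ba$. *)

theory Defs
  imports "HOL-Analysis.Analysis" "HOL-Library.Poly_Mapping" "HOL-Library.Z2"
begin

section \<open>The free algebra with graded involution\<close>

datatype symmetry = Sym | Skew

datatype indet = Y symmetry nat | Z symmetry nat

text \<open>Words form the free monoid, written additively because the convolution product of
  \<open>Poly_Mapping\<close> expects an additive monoid of exponents. Hence \<open>indet list \<Rightarrow>\<^sub>0 'a\<close> with
  its library ring structure is the monoid algebra of the free monoid, that is, the free
  associative unital algebra on the indeterminates.\<close>

instantiation list :: (type) monoid_add
begin
definition plus_list :: "'a list \<Rightarrow> 'a list \<Rightarrow> 'a list" where "plus_list = append"
definition zero_list :: "'a list" where "zero_list = []"
instance by standard (simp_all add: plus_list_def zero_list_def)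
end

type_synonym 'a free_algebra = "indet list \<Rightarrow>\<^sub>0 'a"

definition const :: "'a::field_char_0 \<Rightarrow> 'a free_algebra" where
  "const c = Poly_Mapping.single [] c"

definition var :: "indet \<Rightarrow> 'a::field_char_0 free_algebra" where
  "var x = Poly_Mapping.single [x] 1"

text \<open>The type \<open>bit\<close> is the group of order two, written additively.\<close>

fun indet_degree :: "indet \<Rightarrow> bit" where
  "indet_degree (Y _ _) = 0"
| "indet_degree (Z _ _) = 1"

definition word_degree :: "indet list \<Rightarrow> bit" where
  "word_degree w = sum_list (map indet_degree w)"

definition free_component :: "bit \<Rightarrow> 'a::field_char_0 free_algebra set" where
  "free_component g = {p. \<forall>w\<in>Poly_Mapping.keys p. word_degree w = g}"

fun symmetry_sign :: "symmetry \<Rightarrow> 'a::field_char_0" where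
  "symmetry_sign Sym = 1"
| "symmetry_sign Skew = - 1"

fun indet_symmetry :: "indet \<Rightarrow> symmetry" where
  "indet_symmetry (Y s _) = s"
| "indet_symmetry (Z s _) = s"

definition word_sign :: "indet list \<Rightarrow> 'a::field_char_0" where
  "word_sign w = prod_list (map (\<lambda>x. symmetry_sign (indet_symmetry x)) w)"

text \<open>The linear map with \<open>(x\<^sub>1 \<dots> x\<^sub>n)\<^sup>* = x\<^sub>n\<^sup>* \<dots> x\<^sub>1\<^sup>*\<close>.\<close>

definition free_star :: "'a::field_char_0 free_algebra \<Rightarrow> 'a free_algebra" where
  "free_star p = (\<Sum>w\<in>Poly_Mapping.keys p.
     Poly_Mapping.single (rev w) (word_sign w * Poly_Mapping.lookup p w))"

definition graded_star_endomorphism ::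
    "('a::field_char_0 free_algebra \<Rightarrow> 'a free_algebra) \<Rightarrow> bool" where
  "graded_star_endomorphism \<phi> \<longleftrightarrow>
     \<phi> 1 = 1 \<and>
     (\<forall>p q. \<phi> (p + q) = \<phi> p + \<phi> q) \<and>
     (\<forall>p q. \<phi> (p * q) = \<phi> p * \<phi> q) \<and>
     (\<forall>c p. \<phi> (const c * p) = const c * \<phi> p) \<and>
     (\<forall>g. \<phi> ` free_component g \<subseteq> free_component g) \<and>
     (\<forall>p. \<phi> (free_star p) = free_star (\<phi> p))"

text \<open>The algebra is unital, so closure under multiplication by arbitrary elements includes
  closure under negation and scalar multiplication.\<close>

definition two_sided_ideal :: "'a::field_char_0 free_algebra set \<Rightarrow> bool" where
  "two_sided_ideal I \<longleftrightarrow>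
     0 \<in> I \<and> (\<forall>p\<in>I. \<forall>q\<in>I. p + q \<in> I) \<and> (\<forall>p\<in>I. \<forall>q. q * p \<in> I \<and> p * q \<in> I)"

definition graded_star_T_ideal :: "'a::field_char_0 free_algebra set \<Rightarrow> bool" where
  "graded_star_T_ideal I \<longleftrightarrow>
     two_sided_ideal I \<and> free_star ` I \<subseteq> I \<and>
     (\<forall>\<phi>. graded_star_endomorphism \<phi> \<longrightarrow> \<phi> ` I \<subseteq> I)"

definition generated_T_ideal ::
    "'a::field_char_0 free_algebra set \<Rightarrow> 'a free_algebra set" where
  "generated_T_ideal S = \<Inter>{I. graded_star_T_ideal I \<and> S \<subseteq> I}"


section \<open>The algebra of upper triangular matrices of order three\<close>

text \<open>The order on the numeral type \<open>3\<close> is not \<open>1 < 2 < 3\<close> (there \<open>3 = 0\<close>), so the three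
  entries below the diagonal are listed explicitly. Arithmetic on \<open>3\<close> is modulo three, and
  \<open>4 - i\<close> exchanges \<open>1\<close> and \<open>3\<close> and fixes \<open>2\<close>, as intended.\<close>

definition UT3 :: "('a::field_char_0 ^ 3 ^ 3) set" where
  "UT3 = {A. A $ 2 $ 1 = 0 \<and> A $ 3 $ 1 = 0 \<and> A $ 3 $ 2 = 0}"

definition elementary_matrix :: "3 \<Rightarrow> 3 \<Rightarrow> 'a::field_char_0 ^ 3 ^ 3" where
  "elementary_matrix i j = (\<chi> k l. if k = i \<and> l = j then 1 else 0)"

definition grading_tuple :: "3 \<Rightarrow> bit" where
  "grading_tuple i = (if i = 2 then 1 else 0)"

text \<open>The span of the elementary matrices \<open>E\<^sub>i\<^sub>j\<close> in \<open>UT3\<close> of degree \<open>g\<^sub>i - g\<^sub>j = g\<close>.\<close>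

definition UT3_component :: "bit \<Rightarrow> ('a::field_char_0 ^ 3 ^ 3) set" where
  "UT3_component g =
     {A \<in> UT3. \<forall>i j. A $ i $ j \<noteq> 0 \<longrightarrow> grading_tuple i - grading_tuple j = g}"

definition reflection :: "'a::field_char_0 ^ 3 ^ 3 \<Rightarrow> 'a ^ 3 ^ 3" where
  "reflection A = (\<chi> i j. A $ (4 - j) $ (4 - i))"

lemma reflection_elementary_matrix:
  "reflection (elementary_matrix i j) = elementary_matrix (4 - j) (4 - i)"
  by (auto simp: reflection_def elementary_matrix_def vec_eq_iff)


section \<open>Identities\<close>

definition evaluate :: "(indet \<Rightarrow> 'a ^ 3 ^ 3) \<Rightarrow> 'a::field_char_0 free_algebra \<Rightarrow> 'a ^ 3 ^ 3" where
  "evaluate \<sigma> p = (\<Sum>w\<in>Poly_Mapping.keys p.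
     mat (Poly_Mapping.lookup p w) ** foldr (\<lambda>x A. \<sigma> x ** A) w (mat 1))"

definition admissible :: "(indet \<Rightarrow> 'a::field_char_0 ^ 3 ^ 3) \<Rightarrow> bool" where
  "admissible \<sigma> \<longleftrightarrow>
     (\<forall>n. \<sigma> (Y Sym n) \<in> UT3_component 0 \<and> reflection (\<sigma> (Y Sym n)) = \<sigma> (Y Sym n)) \<and>
     (\<forall>n. \<sigma> (Y Skew n) \<in> UT3_component 0 \<and> reflection (\<sigma> (Y Skew n)) = - \<sigma> (Y Skew n)) \<and>
     (\<forall>n. \<sigma> (Z Sym n) \<in> UT3_component 1 \<and> reflection (\<sigma> (Z Sym n)) = \<sigma> (Z Sym n)) \<and>
     (\<forall>n. \<sigma> (Z Skew n) \<in> UT3_component 1 \<and> reflection (\<sigma> (Z Skew n)) = - \<sigma> (Z Skew n))"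

definition UT3_identities :: "'a::field_char_0 free_algebra set" where
  "UT3_identities = {f. \<forall>\<sigma>. admissible \<sigma> \<longrightarrow> evaluate \<sigma> f = 0}"

definition is_basis_of_UT3_identities :: "'a::field_char_0 free_algebra set \<Rightarrow> bool" where
  "is_basis_of_UT3_identities S \<longleftrightarrow> generated_T_ideal S = UT3_identities"


section \<open>The proposed basis\<close>

definition Y_plus :: "indet set" where "Y_plus = range (Y Sym)"
definition Y_minus :: "indet set" where "Y_minus = range (Y Skew)"
definition Z_plus :: "indet set" where "Z_plus = range (Z Sym)"
definition Z_minus :: "indet set" where "Z_minus = range (Z Skew)"
definition Z_all :: "indet set" where "Z_all = Z_plus \<union> Z_minus"

definition commutator ::
    "'a::field_char_0 free_algebra \<Rightarrow> 'a free_algebra \<Rightarrow> 'a free_algebra" where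
  "commutator p q = p * q - q * p"

text \<open>Distinct letters stand for distinct indeterminates. Distinctness is stated only between
  letters that are not already separated by the disjoint sets they range over.\<close>

inductive_set basis_polynomials :: "'a::field_char_0 free_algebra set" where
  id1: "var x1 * var x2 * var x3 - var x3 * var x2 * var x1 \<in> basis_polynomials"
    if "A \<in> {Y_minus, Z_plus, Z_minus}" "x1 \<in> A" "x3 \<in> A" "distinct [x1, x2, x3]"
| id2: "var z1 * var z2 * var z3 \<in> basis_polynomials"
    if "z1 \<in> Z_all" "z2 \<in> Z_all" "z3 \<in> Z_all" "distinct [z1, z2, z3]"
| id3: "commutator (var x1) (var x2) \<in> basis_polynomials"
    if "A \<in> {Y_plus, Y_minus, Z_plus, Z_minus}" "x1 \<in> A" "x2 \<in> A" "x1 \<noteq> x2"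
| id4: "commutator (var y1) (var y2) * commutator (var x3) (var x4) \<in> basis_polynomials"
    if "y1 \<in> Y_plus" "y2 \<in> Y_minus" "distinct [y1, y2, x3, x4]"
| id5: "commutator (var y1) (var z1 * var z2) \<in> basis_polynomials"
    if "y1 \<in> Y_plus" "z1 \<in> Z_all" "z2 \<in> Z_all" "z1 \<noteq> z2"
| id6_left: "commutator (var y1) (var y2) * var z3 \<in> basis_polynomials"
    if "y1 \<in> Y_plus" "y2 \<in> Y_minus" "z3 \<in> Z_all"
| id6_right: "var z3 * commutator (var y1) (var y2) \<in> basis_polynomials"
    if "y1 \<in> Y_plus" "y2 \<in> Y_minus" "z3 \<in> Z_all"
| id7: "commutator (var y1) (var y2) * var y3 + var y3 * commutator (var y1) (var y2)
      \<in> basis_polynomials"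
    if "y1 \<in> Y_plus" "y2 \<in> Y_minus" "y3 \<in> Y_minus" "y2 \<noteq> y3"
| id8: "var y1 * var z1 * var y2 \<in> basis_polynomials"
    if "y1 \<in> Y_minus" "y2 \<in> Y_minus" "z1 \<in> Z_all" "y1 \<noteq> y2"
| id9: "var z1 * var y1 * var z2 \<in> basis_polynomials"
    if "z1 \<in> Z_all" "z2 \<in> Z_all" "y1 \<in> Y_minus" "z1 \<noteq> z2"
| id10: "var z1 * var z2 + var z2 * var z1 \<in> basis_polynomials"
    if "z1 \<in> Z_plus" "z2 \<in> Z_minus"
| id11: "var z1 * var z2 * var y1 + var y1 * var z1 * var z2 \<in> basis_polynomials"
    if "z1 \<in> Z_all" "z2 \<in> Z_all" "y1 \<in> Y_minus" "z1 \<noteq> z2"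

end

theory Submission
  imports Defs
begin

text \<open>The polynomials of the list are identities by direct computation. For the converse one works
  in the free algebra modulo the T-ideal that they generate. There a word with three letters of
  degree one vanishes, and a word with one or two such letters is zero or, up to a sign,
  determined by the monomial that it contributes to an entry of its value at generic matrices.
  A word in letters of degree zero is a sorted word plus integer multiples of words with one
  commutator \<open>[y\<^sup>-, y\<^sup>+]\<close>, and these integers can be read off the corner entry. As distinct
  monomials are linearly independent functions over an infinite field, the coefficients of an
  identity cancel within each class of words that agree in the quotient.\<close>

section \<open>The free algebra\<close>

text \<open>Reductions need the basis polynomials at whole blocks of letters, and such blocks may be
  symmetric or skew only modulo the T-ideal. This is why the quotient gets its own grading and
  involution: 2 being invertible, an element of given degree and symmetry has a representative with
  the same properties, so the basis polynomials vanish at it. The rows of generic matrices separate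
  words. A word with one letter z of degree one is visible in row 1 if no skew letter follows z, in
  row 2 if none precedes it, and is zero in the quotient if neither holds. Words visible in both
  rows must not be counted twice: row 2 serves only those invisible in row 1, and this selection has
  to be readable from the monomial. With two letters of degree one only row 1 can be nonzero, and it
  is so exactly if no skew letter stands between them. For words in degree-zero letters the diagonal
  sees at most the content and a sign; a commutator of a skew and a symmetric letter shows in the
  corner alone. Hence the corner parameters, switched on for one symmetric letter at a time.\<close>

lemma poly_mapping_eq_sum_single:
  "p = (\<Sum>w\<in>Poly_Mapping.keys p. Poly_Mapping.single w (Poly_Mapping.lookup p w))"
  by (rule poly_mapping_eqI)
    (simp add: lookup_sum lookup_single when_def not_in_keys_iff_lookup_eq_zero)

lemma poly_mapping_keys_induct:
  fixes p :: "'k \<Rightarrow>\<^sub>0 'b::comm_monoid_add"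
  assumes "P 0" "\<And>p q. P p \<Longrightarrow> P q \<Longrightarrow> P (p + q)"
    and single: "\<And>w c. w \<in> Poly_Mapping.keys p \<Longrightarrow> P (Poly_Mapping.single w c)"
  shows "P p"
proof -
  have "P (\<Sum>w\<in>K. Poly_Mapping.single w (Poly_Mapping.lookup p w))"
    if "finite K" "K \<subseteq> Poly_Mapping.keys p" for K
    using that by (induction rule: finite_induct) (auto intro: assms)
  from this[OF finite_keys order_refl] show ?thesis
    by (simp flip: poly_mapping_eq_sum_single)
qed

lemma free_algebra_induct [case_names zero add single]:
  fixes p :: "'k \<Rightarrow>\<^sub>0 'b::comm_monoid_add"
  assumes "P 0" "\<And>p q. P p \<Longrightarrow> P q \<Longrightarrow> P (p + q)" "\<And>w c. P (Poly_Mapping.single w c)"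
  shows "P p"
  by (rule poly_mapping_keys_induct) (auto intro: assms)

lemma single_mult_single:
  "Poly_Mapping.single u a * Poly_Mapping.single v b = Poly_Mapping.single (u @ v) (a * b)"
  for a b :: "'a::semiring_0"
  by (simp add: mult_single plus_list_def)

lemma one_eq_single: "(1 :: 'a::field_char_0 free_algebra) = Poly_Mapping.single [] 1"
  by (metis single_one zero_list_def)

lemma const_mult_single:
  "const c * Poly_Mapping.single w a = Poly_Mapping.single w (c * a)"
  by (simp add: const_def single_mult_single)

lemma const_add: "const (a + b) = const a + const b"
  by (simp add: const_def single_add)

lemma const_mult: "const (a * b) = const a * const b"
  by (simp add: const_def single_mult_single)

lemma const_0 [simp]: "const 0 = 0"
  by (simp add: const_def)

lemma const_1 [simp]: "const 1 = 1"
  by (simp add: const_def one_eq_single)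

lemma const_central: "const c * p = p * const c"
  by (induction p rule: free_algebra_induct)
    (simp_all add: algebra_simps const_def single_mult_single)

lemma single_Cons:
  "Poly_Mapping.single (x # w) c = var x * Poly_Mapping.single w c"
  by (simp add: var_def single_mult_single)

locale scalar_algebra =
  fixes mul :: "'r::ab_group_add \<Rightarrow> 'r \<Rightarrow> 'r" and one :: 'r
    and scal :: "'a::field_char_0 \<Rightarrow> 'r"
  assumes mul_assoc: "mul (mul x y) z = mul x (mul y z)"
    and one_left: "mul one x = x" and one_right: "mul x one = x"
    and mul_add_left: "mul (x + y) z = mul x z + mul y z"
    and mul_add_right: "mul x (y + z) = mul x y + mul x z"
    and scal_add: "scal (a + b) = scal a + scal b"
    and scal_mult: "scal (a * b) = mul (scal a) (scal b)"
    and scal_one: "scal 1 = one"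
    and scal_central: "mul (scal a) x = mul x (scal a)"
begin

definition word_value :: "(indet \<Rightarrow> 'r) \<Rightarrow> indet list \<Rightarrow> 'r" where
  "word_value s w = foldr (\<lambda>x. mul (s x)) w one"

definition extension :: "(indet \<Rightarrow> 'r) \<Rightarrow> 'a free_algebra \<Rightarrow> 'r" where
  "extension s p =
     (\<Sum>w\<in>Poly_Mapping.keys p. mul (scal (Poly_Mapping.lookup p w)) (word_value s w))"

lemma mul_zero_left: "mul 0 x = 0"
  using mul_add_left[of 0 0 x] by simp

lemma mul_zero_right: "mul x 0 = 0"
  using mul_add_right[of x 0 0] by simp

lemma scal_zero: "scal 0 = 0"
  using scal_add[of 0 0] by simp

lemma word_value_Nil [simp]: "word_value s [] = one"
  by (simp add: word_value_def)

lemma word_value_Cons [simp]: "word_value s (x # w) = mul (s x) (word_value s w)"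
  by (simp add: word_value_def)

lemma word_value_append: "word_value s (u @ v) = mul (word_value s u) (word_value s v)"
  by (induction u) (simp_all add: mul_assoc one_left)

lemma extension_zero: "extension s 0 = 0"
  by (simp add: extension_def)

lemma extension_add: "extension s (p + q) = extension s p + extension s q"
  unfolding extension_def
  by (rule setsum_keys_plus_distrib) (simp_all add: scal_zero mul_zero_left scal_add mul_add_left)

lemma extension_single:
  "extension s (Poly_Mapping.single w c) = mul (scal c) (word_value s w)"
  by (simp add: extension_def scal_zero mul_zero_left)

lemma extension_mult: "extension s (p * q) = mul (extension s p) (extension s q)"
proof (induction p rule: free_algebra_induct)
  case (single u a)
  show ?case
  proof (induction q rule: free_algebra_induct)
    case (single v b)
    have "mul (scal (a * b)) (word_value s (u @ v)) =
        mul (scal a) (mul (mul (scal b) (word_value s u)) (word_value s v))"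
      by (simp only: scal_mult word_value_append mul_assoc)
    also have "\<dots> = mul (mul (scal a) (word_value s u)) (mul (scal b) (word_value s v))"
      by (simp only: scal_central[of b] mul_assoc)
    finally show ?case
      by (simp add: single_mult_single extension_single)
  qed (simp_all add: extension_zero extension_add distrib_left mul_zero_right mul_add_right)
qed (simp_all add: extension_zero extension_add distrib_right mul_zero_left mul_add_left)

lemma extension_one: "extension s 1 = one"
  by (simp add: one_eq_single extension_single scal_one one_left)

lemma extension_const: "extension s (const c) = scal c"
  by (simp add: const_def extension_single one_right)

lemma extension_var: "extension s (var x) = s x"
  by (simp add: var_def extension_single scal_one one_left one_right)

text \<open>This identifies composites: evaluation after an endomorphism, projection after a
  substitution, and the projection to the quotient are all extensions of their values on
  letters.\<close>

lemma extension_unique: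
  assumes add: "\<And>p q. \<phi> (p + q) = \<phi> p + \<phi> q"
    and mult: "\<And>p q. \<phi> (p * q) = mul (\<phi> p) (\<phi> q)"
    and const: "\<And>c. \<phi> (const c) = scal c"
  shows "\<phi> p = extension (\<lambda>x. \<phi> (var x)) p"
proof (induction p rule: free_algebra_induct)
  case zero
  show ?case
    using const[of 0] by (simp add: extension_zero scal_zero)
next
  case (single w c)
  have "\<phi> (Poly_Mapping.single w 1) = word_value (\<lambda>x. \<phi> (var x)) w"
  proof (induction w)
    case Nil
    then show ?case
      using const[of 1] by (simp add: const_def scal_one)
  next
    case (Cons x w)
    then show ?case
      by (simp add: single_Cons mult)
  qed
  moreover have "Poly_Mapping.single w c = const c * Poly_Mapping.single w 1"
    by (simp add: const_mult_single)
  ultimately show ?case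
    by (metis mult const extension_single)
qed (simp add: add extension_add)

end

interpretation free_alg: scalar_algebra "(*)" "1 :: 'a::field_char_0 free_algebra" const
  by unfold_locales
    (simp_all only: mult.assoc mult_1_left mult_1_right distrib_left distrib_right
      const_add const_mult const_1, rule const_central)

lemma mat_scalar_mult: "mat c ** A = (\<chi> i j. c * A $ i $ j)"
  for A :: "'a::field_char_0 ^ 'n ^ 'n"
  by (simp add: matrix_matrix_mult_def mat_def vec_eq_iff if_distrib[where f = "\<lambda>a. a * _"]
      sum.delta cong: if_cong)

lemma mult_mat_scalar: "A ** mat c = (\<chi> i j. c * A $ i $ j)"
  for A :: "'a::field_char_0 ^ 'n ^ 'n"
  by (simp add: matrix_matrix_mult_def mat_def vec_eq_iff if_distrib[where f = "\<lambda>a. _ * a"]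
      sum.delta mult.commute cong: if_cong)

lemma matrix_add_rdistrib: "(A + B) ** C = A ** C + B ** C"
  for A B :: "'a::semiring_1 ^ 'n ^ 'm"
  by (simp add: matrix_matrix_mult_def vec_eq_iff distrib_right sum.distrib)

interpretation matr: scalar_algebra "(**)" "mat 1 :: 'a::field_char_0 ^ 3 ^ 3" mat
  apply unfold_locales
  apply (simp_all add: matrix_mul_assoc[symmetric] matrix_add_ldistrib matrix_add_rdistrib
      mat_scalar_mult mult_mat_scalar)
  apply (simp_all add: mat_def vec_eq_iff)
  done

lemma evaluate_eq_extension: "evaluate = matr.extension"
  by (intro ext) (simp add: evaluate_def matr.extension_def matr.word_value_def)

lemmas evaluate_simps =
  matr.extension_zero[folded evaluate_eq_extension]
  matr.extension_add[folded evaluate_eq_extension]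
  matr.extension_mult[folded evaluate_eq_extension]
  matr.extension_one[folded evaluate_eq_extension]
  matr.extension_const[folded evaluate_eq_extension]
  matr.extension_var[folded evaluate_eq_extension]

section \<open>Involution, grading and substitutions of the free algebra\<close>

lemma free_star_add: "free_star (p + q) = free_star p + free_star q"
  unfolding free_star_def
  by (rule setsum_keys_plus_distrib) (simp_all add: distrib_left single_add)

lemma free_star_zero [simp]: "free_star 0 = 0"
  by (simp add: free_star_def)

lemma free_star_single:
  "free_star (Poly_Mapping.single w c) = Poly_Mapping.single (rev w) (word_sign w * c)"
  by (simp add: free_star_def)

lemma word_sign_append: "word_sign (u @ v) = word_sign u * word_sign v"
  by (simp add: word_sign_def)

lemma word_sign_rev: "word_sign (rev w) = word_sign w"
  by (induction w) (simp_all add: word_sign_def)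

lemma symmetry_sign_square: "symmetry_sign s * symmetry_sign s = 1"
  by (cases s) simp_all

lemma word_sign_square: "word_sign w * word_sign w = 1"
proof (induction w)
  case (Cons x w)
  have "word_sign (x # w) * word_sign (x # w) =
      (symmetry_sign (indet_symmetry x) * symmetry_sign (indet_symmetry x)) *
      (word_sign w * word_sign w :: 'a)"
    by (simp add: word_sign_def algebra_simps)
  then show ?case
    by (simp add: Cons.IH symmetry_sign_square)
qed (simp add: word_sign_def)

lemma free_star_mult: "free_star (p * q) = free_star q * free_star p"
proof (induction p rule: free_algebra_induct)
  case (single u a)
  show ?case
  proof (induction q rule: free_algebra_induct)
    case (single v b)
    show ?case
      by (simp add: single_mult_single free_star_single word_sign_append algebra_simps)
  qed (simp_all add: free_star_add algebra_simps)
qed (simp_all add: free_star_add algebra_simps)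

lemma free_star_involutive: "free_star (free_star p) = p"
proof (induction p rule: free_algebra_induct)
  case (single w c)
  have "word_sign w * (word_sign w * c) = c"
    by (metis word_sign_square mult.assoc mult_1)
  then show ?case
    by (simp only: free_star_single word_sign_rev rev_rev_ident)
qed (simp_all add: free_star_add)

lemma free_star_const: "free_star (const c) = const c"
  by (simp add: const_def free_star_single word_sign_def)

lemma free_star_const_mult: "free_star (const c * p) = const c * free_star p"
  by (simp add: free_star_mult free_star_const const_central[of c])

lemma free_star_one: "free_star 1 = 1"
  by (metis const_1 free_star_const)

lemma free_star_uminus: "free_star (- p) = - free_star p"
  by (metis add_eq_0_iff free_star_add free_star_zero)

lemma free_star_diff: "free_star (p - q) = free_star p - free_star q"
  by (simp add: diff_conv_add_uminus free_star_add free_star_uminus del: add_uminus_conv_diff)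

lemma free_star_var: "free_star (var x) = const (symmetry_sign (indet_symmetry x)) * var x"
  by (simp add: var_def free_star_single word_sign_def const_mult_single)

lemma free_component_zero: "0 \<in> free_component g"
  by (simp add: free_component_def)

lemma free_component_add:
  "p \<in> free_component g \<Longrightarrow> q \<in> free_component g \<Longrightarrow> p + q \<in> free_component g"
  using keys_add[of p q] by (auto simp: free_component_def)

lemma free_component_single: "Poly_Mapping.single w c \<in> free_component (word_degree w)"
  by (simp add: free_component_def)

lemma word_degree_append: "word_degree (u @ v) = word_degree u + word_degree v"
  by (simp add: word_degree_def)

lemma free_component_mult:
  assumes "p \<in> free_component g" "q \<in> free_component h"
  shows "p * q \<in> free_component (g + h)"
  using keys_mult[of p q] assms
  by (fastforce simp: free_component_def plus_list_def word_degree_append)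

lemma free_component_const: "const c \<in> free_component 0"
  using free_component_single[of "[]" c] by (simp add: const_def word_degree_def)

lemma free_component_const_mult:
  "p \<in> free_component g \<Longrightarrow> const c * p \<in> free_component g"
  by (metis free_component_mult free_component_const add_0)

lemma word_degree_singleton: "word_degree [x] = indet_degree x"
  by (simp only: word_degree_def list.map sum_list.Cons sum_list.Nil add_0_right)

lemma free_component_var: "var x \<in> free_component (indet_degree x)"
  unfolding var_def by (metis free_component_single word_degree_singleton)

lemma word_degree_rev: "word_degree (rev w) = word_degree w"
proof (induction w)
  case (Cons x w)
  have "word_degree (rev (x # w)) = word_degree w + indet_degree x"
    by (simp only: rev.simps word_degree_append word_degree_singleton Cons.IH)
  then show ?case
    using word_degree_append[of "[x]" w] by (simp only: word_degree_singleton add.commute append.simps)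
qed (simp add: word_degree_def)

lemma free_component_induct [consumes 1, case_names zero add single]:
  assumes "p \<in> free_component g"
    and "P 0" "\<And>p q. P p \<Longrightarrow> P q \<Longrightarrow> P (p + q)"
      "\<And>w c. word_degree w = g \<Longrightarrow> P (Poly_Mapping.single w c)"
  shows "P p"
  by (rule poly_mapping_keys_induct) (use assms in \<open>auto simp: free_component_def\<close>)

lemma free_component_star:
  assumes "p \<in> free_component g"
  shows "free_star p \<in> free_component g"
  using assms
proof (induction rule: free_component_induct)
  case (single w c)
  then show ?case
    using free_component_single[of "rev w"] by (simp add: free_star_single word_degree_rev)
qed (simp_all add: free_component_zero free_star_add free_component_add)

text \<open>The counterpart of \<open>admissible\<close> inside the free algebra: the conditions on
  letters under which a substitution respects grading and involution.\<close>

definition admissible_substitution :: "(indet \<Rightarrow> 'a::field_char_0 free_algebra) \<Rightarrow> bool" where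
  "admissible_substitution s \<longleftrightarrow>
     (\<forall>x. s x \<in> free_component (indet_degree x) \<and>
          free_star (s x) = const (symmetry_sign (indet_symmetry x)) * s x)"

lemma admissible_substitution_word_degree:
  assumes "admissible_substitution s"
  shows "free_alg.word_value s w \<in> free_component (word_degree w)"
proof (induction w)
  case Nil
  then show ?case
    using free_component_const[of 1] by (simp add: word_degree_def)
next
  case (Cons x w)
  then show ?case
    using free_component_mult[of "s x" "indet_degree x"] assms
    by (simp add: word_degree_def admissible_substitution_def)
qed

lemma admissible_substitution_word_star:
  assumes "admissible_substitution s"
  shows "free_star (free_alg.word_value s w) =
    const (word_sign w) * free_alg.word_value s (rev w)"
proof (induction w)
  case Nil
  then show ?case
    by (simp add: free_star_one word_sign_def)
next
  case (Cons x w)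
  let ?e = "symmetry_sign (indet_symmetry x)"
  have "free_star (free_alg.word_value s (x # w)) =
      (const (word_sign w) * free_alg.word_value s (rev w)) * (const ?e * s x)"
    using assms by (simp add: free_star_mult Cons.IH admissible_substitution_def)
  also have "\<dots> = const (word_sign w) * (free_alg.word_value s (rev w) * const ?e) * s x"
    by (simp only: mult.assoc)
  also have "\<dots> = const (word_sign w * ?e) * free_alg.word_value s (rev (x # w))"
    by (simp add: const_central[of ?e "free_alg.word_value s (rev w)", symmetric]
        const_mult free_alg.word_value_append mult.assoc)
  finally show ?case
    by (simp add: word_sign_def mult.commute)
qed

text \<open>Both sides are additive, so degree and involution need checking only on words, where
  they follow letter by letter.\<close>

lemma graded_star_endomorphism_extension:
  assumes "admissible_substitution s"
  shows "graded_star_endomorphism (free_alg.extension s)"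
proof -
  have "free_alg.extension s p \<in> free_component g" if "p \<in> free_component g" for g p
    using that
    by (induction rule: free_component_induct)
      (auto simp: free_alg.extension_zero free_alg.extension_add free_alg.extension_single
        free_component_zero intro!: free_component_add free_component_const_mult
        admissible_substitution_word_degree[OF assms])
  moreover have "free_alg.extension s (free_star p) = free_star (free_alg.extension s p)" for p
  proof (induction p rule: free_algebra_induct)
    case (single w c)
    have "free_star (const c * free_alg.word_value s w) =
        const (c * word_sign w) * free_alg.word_value s (rev w)"
      by (simp only: free_star_const_mult admissible_substitution_word_star[OF assms]
          const_mult mult.assoc)
    then show ?case
      by (simp add: free_star_single free_alg.extension_single mult.commute)
  qed (simp_all add: free_star_add free_alg.extension_add free_alg.extension_zero)
  ultimately show ?thesis
    by (auto simp: graded_star_endomorphism_def free_alg.extension_one free_alg.extension_add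
        free_alg.extension_mult free_alg.extension_const)
qed

section \<open>The identities of upper triangular matrices form a T-ideal\<close>

text \<open>Coordinates in the order (1,1), (2,2), (3,3), (1,2), (2,3), (1,3). Degree one is carried
  by the fourth and fifth, degree zero by the others. The reflection exchanges the first with the
  third and the fourth with the fifth.\<close>

definition ut3 :: "'a \<Rightarrow> 'a \<Rightarrow> 'a \<Rightarrow> 'a \<Rightarrow> 'a \<Rightarrow> 'a \<Rightarrow> 'a::field_char_0 ^ 3 ^ 3" where
  "ut3 a b c p q r = (\<chi> i j.
     if i = 1 \<and> j = 1 then a else if i = 2 \<and> j = 2 then b else if i = 3 \<and> j = 3 then c
     else if i = 1 \<and> j = 2 then p else if i = 2 \<and> j = 3 then q
     else if i = 1 \<and> j = 3 then r else 0)"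

lemma four_minus: "4 - 2 = (2::3)" "4 - 3 = (1::3)"
  by simp_all

lemma ut3_nth [simp]:
  "ut3 a b c p q r $ 1 $ 1 = a" "ut3 a b c p q r $ 2 $ 2 = b" "ut3 a b c p q r $ 3 $ 3 = c"
  "ut3 a b c p q r $ 1 $ 2 = p" "ut3 a b c p q r $ 2 $ 3 = q" "ut3 a b c p q r $ 1 $ 3 = r"
  "ut3 a b c p q r $ 2 $ 1 = 0" "ut3 a b c p q r $ 3 $ 1 = 0" "ut3 a b c p q r $ 3 $ 2 = 0"
  by (simp_all add: ut3_def)

lemma ut3_eq_iff:
  "ut3 a b c p q r = ut3 a' b' c' p' q' r' \<longleftrightarrow>
     a = a' \<and> b = b' \<and> c = c' \<and> p = p' \<and> q = q' \<and> r = r'"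
  by (metis ut3_nth(1-6))

lemma ut3_zero: "0 = ut3 0 0 0 0 0 0"
  by (simp add: vec_eq_iff ut3_def)

lemma mat_eq_ut3: "mat c = ut3 c c c 0 0 0"
  by (simp add: vec_eq_iff forall_3 mat_def)

lemma ut3_add:
  "ut3 a b c p q r + ut3 a' b' c' p' q' r' = ut3 (a + a') (b + b') (c + c') (p + p') (q + q') (r + r')"
  by (simp add: vec_eq_iff forall_3)

lemma ut3_uminus: "- ut3 a b c p q r = ut3 (- a) (- b) (- c) (- p) (- q) (- r)"
  by (simp add: vec_eq_iff forall_3)

lemma ut3_mult:
  "ut3 a b c p q r ** ut3 a' b' c' p' q' r' =
     ut3 (a * a') (b * b') (c * c') (a * p' + p * b') (b * q' + q * c')
       (a * r' + p * q' + r * c')"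
  by (simp add: vec_eq_iff forall_3 matrix_matrix_mult_def sum_3)

lemma reflection_ut3: "reflection (ut3 a b c p q r) = ut3 c b a q p r"
  unfolding vec_eq_iff forall_3 reflection_def by (simp add: four_minus)

lemma UT3_obtain:
  assumes "A \<in> UT3"
  obtains a b c p q r where "A = ut3 a b c p q r"
proof
  show "A = ut3 (A $ 1 $ 1) (A $ 2 $ 2) (A $ 3 $ 3) (A $ 1 $ 2) (A $ 2 $ 3) (A $ 1 $ 3)"
    using assms by (simp add: vec_eq_iff forall_3 UT3_def)
qed

lemma ut3_component_0: "ut3 a b c p q r \<in> UT3_component 0 \<longleftrightarrow> p = 0 \<and> q = 0"
  by (auto simp: UT3_component_def UT3_def forall_3 grading_tuple_def)

lemma ut3_component_1: "ut3 a b c p q r \<in> UT3_component 1 \<longleftrightarrow> a = 0 \<and> b = 0 \<and> c = 0 \<and> r = 0"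
  by (auto simp: UT3_component_def UT3_def forall_3 grading_tuple_def)

lemma UT3_component_0E:
  assumes "A \<in> UT3_component 0"
  obtains a b c r where "A = ut3 a b c 0 0 r"
proof -
  have "A \<in> UT3"
    using assms by (simp add: UT3_component_def)
  then show ?thesis
    using assms that by (auto elim!: UT3_obtain simp: ut3_component_0)
qed

lemma UT3_component_1E:
  assumes "A \<in> UT3_component 1"
  obtains p q where "A = ut3 0 0 0 p q 0"
proof -
  have "A \<in> UT3"
    using assms by (simp add: UT3_component_def)
  then show ?thesis
    using assms that by (auto elim!: UT3_obtain simp: ut3_component_1)
qed

lemma bit_cases: "g = 0 \<or> g = 1" for g :: bit
  by (cases g) auto

lemma UT3_component_zero: "0 \<in> UT3_component g"
  using bit_cases[of g] by (auto simp: ut3_zero ut3_component_0 ut3_component_1)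

lemma UT3_component_add:
  "A \<in> UT3_component g \<Longrightarrow> B \<in> UT3_component g \<Longrightarrow> A + B \<in> UT3_component g"
  using bit_cases[of g]
  by (auto simp: ut3_component_0 ut3_component_1 ut3_add elim!: UT3_component_0E UT3_component_1E)

lemma UT3_component_mult:
  assumes "A \<in> UT3_component g" "B \<in> UT3_component h"
  shows "A ** B \<in> UT3_component (g + h)"
proof -
  have "(1::bit) + 1 = 0" by simp
  then show ?thesis
    using bit_cases[of g] bit_cases[of h] assms
    by (auto simp: ut3_component_0 ut3_component_1 ut3_mult
        elim!: UT3_component_0E UT3_component_1E)
qed

lemma UT3_component_mat: "mat c \<in> UT3_component 0"
  by (simp add: mat_eq_ut3 ut3_component_0)

lemma UT3_component_scale: "A \<in> UT3_component g \<Longrightarrow> mat c ** A \<in> UT3_component g"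
  using UT3_component_mult[OF UT3_component_mat] by (metis add_0)

lemma UT3_component_imp_UT3: "A \<in> UT3_component g \<Longrightarrow> A \<in> UT3"
  by (simp add: UT3_component_def)

lemma reflection_add: "reflection (A + B) = reflection A + reflection B"
  by (simp add: reflection_def vec_eq_iff)

lemma reflection_mult: "reflection (A ** B) = reflection B ** reflection A"
proof -
  have "(\<Sum>k\<in>UNIV. A $ (4 - j) $ k * B $ k $ (4 - i)) =
      (\<Sum>k\<in>UNIV. B $ (4 - k) $ (4 - i) * A $ (4 - j) $ (4 - k))" for i j
    by (rule sum.reindex_bij_witness[of _ "\<lambda>k. 4 - k" "\<lambda>k. 4 - k"]) (simp_all add: mult.commute)
  then show ?thesis
    by (simp add: reflection_def matrix_matrix_mult_def vec_eq_iff)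
qed

lemma all_indet:
  "(\<forall>x. P x) \<longleftrightarrow> (\<forall>n. P (Y Sym n)) \<and> (\<forall>n. P (Y Skew n)) \<and> (\<forall>n. P (Z Sym n)) \<and>
    (\<forall>n. P (Z Skew n))"
proof (intro iffI allI)
  fix x
  assume "(\<forall>n. P (Y Sym n)) \<and> (\<forall>n. P (Y Skew n)) \<and> (\<forall>n. P (Z Sym n)) \<and>
    (\<forall>n. P (Z Skew n))"
  moreover obtain s n where "x = Y s n \<or> x = Z s n"
    by (cases x) auto
  ultimately show "P x"
    by (cases s) auto
qed simp

text \<open>A single condition for all letters, with the sign as a scalar matrix, makes the
  inductions over words uniform.\<close>

lemma admissible_iff:
  "admissible \<sigma> \<longleftrightarrow> (\<forall>x. \<sigma> x \<in> UT3_component (indet_degree x) \<and>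
     reflection (\<sigma> x) = mat (symmetry_sign (indet_symmetry x)) ** \<sigma> x)"
proof -
  have *: "mat (- 1) ** A = - A" for A :: "'a ^ 3 ^ 3"
    by (simp add: mat_scalar_mult vec_eq_iff)
  show ?thesis
    unfolding all_indet by (simp add: admissible_def *)
qed

lemma evaluate_single:
  "evaluate \<sigma> (Poly_Mapping.single w c) = mat c ** matr.word_value \<sigma> w"
  by (simp add: evaluate_eq_extension matr.extension_single)

lemma word_value_component:
  assumes "admissible \<sigma>"
  shows "matr.word_value \<sigma> w \<in> UT3_component (word_degree w)"
proof (induction w)
  case Nil
  then show ?case
    by (simp add: UT3_component_mat word_degree_def)
next
  case (Cons x w)
  have "\<sigma> x \<in> UT3_component (indet_degree x)"
    using assms by (simp add: admissible_iff)
  from UT3_component_mult[OF this Cons.IH] show ?case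
    by (simp only: word_degree_def list.map sum_list.Cons matr.word_value_Cons)
qed

lemma evaluate_component:
  assumes "admissible \<sigma>" "p \<in> free_component g"
  shows "evaluate \<sigma> p \<in> UT3_component g"
  using assms(2)
  by (induction rule: free_component_induct)
    (auto simp: evaluate_simps evaluate_single UT3_component_zero
      intro!: UT3_component_add UT3_component_scale word_value_component[OF assms(1)])

lemma reflection_mat: "reflection (mat c) = mat c"
  by (simp add: mat_eq_ut3 reflection_ut3)

lemma reflection_word_value:
  assumes "admissible \<sigma>"
  shows "reflection (matr.word_value \<sigma> w) = mat (word_sign w) ** matr.word_value \<sigma> (rev w)"
proof (induction w)
  case Nil
  then show ?case
    by (simp add: reflection_mat word_sign_def)
next
  case (Cons x w)
  let ?e = "symmetry_sign (indet_symmetry x)"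
  have "reflection (matr.word_value \<sigma> (x # w)) =
      mat (word_sign w) ** (matr.word_value \<sigma> (rev w) ** mat ?e) ** \<sigma> x"
    using assms by (simp add: reflection_mult Cons.IH admissible_iff matrix_mul_assoc)
  also have "\<dots> = mat (word_sign w * ?e) ** matr.word_value \<sigma> (rev (x # w))"
    by (simp add: matr.scal_central[of ?e "matr.word_value \<sigma> (rev w)", symmetric]
        matr.scal_mult matr.word_value_append matrix_mul_assoc)
  finally show ?case
    by (simp add: word_sign_def mult.commute)
qed

lemma reflection_evaluate:
  assumes "admissible \<sigma>"
  shows "reflection (evaluate \<sigma> p) = evaluate \<sigma> (free_star p)"
proof (induction p rule: free_algebra_induct)
  case zero
  show ?case
    by (simp add: evaluate_simps) (simp add: ut3_zero reflection_ut3)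
next
  case (single w c)
  have "reflection (mat c ** matr.word_value \<sigma> w) =
      mat (c * word_sign w) ** matr.word_value \<sigma> (rev w)"
    by (simp only: reflection_mult reflection_mat reflection_word_value[OF assms]
        matr.scal_mult matr.scal_central[of c, symmetric] matrix_mul_assoc)
  then show ?case
    by (simp add: evaluate_single free_star_single mult.commute)
qed (simp add: free_star_add reflection_add evaluate_simps)

lemma graded_star_endomorphismD:
  assumes "graded_star_endomorphism \<phi>"
  shows "\<phi> 1 = 1" "\<phi> (p + q) = \<phi> p + \<phi> q" "\<phi> (p * q) = \<phi> p * \<phi> q"
    "\<phi> (const c * p) = const c * \<phi> p" "\<phi> ` free_component g \<subseteq> free_component g"
    "\<phi> (free_star p) = free_star (\<phi> p)"
  using assms unfolding graded_star_endomorphism_def by meson+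

lemma graded_star_endomorphism_const:
  assumes "graded_star_endomorphism \<phi>"
  shows "\<phi> (const c) = const c"
  using graded_star_endomorphismD(4)[OF assms, of c 1] graded_star_endomorphismD(1)[OF assms]
  by simp

lemma evaluate_endomorphism:
  assumes "graded_star_endomorphism \<phi>"
  shows "evaluate \<sigma> (\<phi> p) = evaluate (\<lambda>x. evaluate \<sigma> (\<phi> (var x))) p"
  unfolding evaluate_eq_extension
proof (rule matr.extension_unique)
  show "matr.extension \<sigma> (\<phi> (const c)) = mat c" for c
    by (simp add: graded_star_endomorphism_const[OF assms] matr.extension_const)
qed (simp_all add: graded_star_endomorphismD(2,3)[OF assms] matr.extension_add
    matr.extension_mult)

text \<open>Together with \<open>evaluate_endomorphism\<close> this turns the evaluation of an image
  under \<open>\<phi>\<close> into an evaluation at another admissible assignment, whence identities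
  are closed under endomorphisms.\<close>

lemma admissible_endomorphism:
  assumes \<phi>: "graded_star_endomorphism \<phi>" and \<sigma>: "admissible \<sigma>"
  shows "admissible (\<lambda>x. evaluate \<sigma> (\<phi> (var x)))"
  unfolding admissible_iff
proof (intro allI conjI)
  fix x
  let ?e = "symmetry_sign (indet_symmetry x)"
  have "\<phi> ` free_component (indet_degree x) \<subseteq> free_component (indet_degree x)"
    by (rule graded_star_endomorphismD(5)[OF \<phi>])
  then have "\<phi> (var x) \<in> free_component (indet_degree x)"
    using free_component_var by blast
  then show "evaluate \<sigma> (\<phi> (var x)) \<in> UT3_component (indet_degree x)"
    by (rule evaluate_component[OF \<sigma>])
  have "free_star (\<phi> (var x)) = const ?e * \<phi> (var x)"
    by (simp only: graded_star_endomorphismD(6)[OF \<phi>, symmetric] free_star_var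
        graded_star_endomorphismD(4)[OF \<phi>])
  then show "reflection (evaluate \<sigma> (\<phi> (var x))) = mat ?e ** evaluate \<sigma> (\<phi> (var x))"
    by (simp add: reflection_evaluate[OF \<sigma>] evaluate_simps)
qed

lemma graded_star_T_ideal_UT3_identities:
  "graded_star_T_ideal (UT3_identities :: 'a::field_char_0 free_algebra set)"
  unfolding graded_star_T_ideal_def two_sided_ideal_def
proof (intro conjI)
  show "free_star ` UT3_identities \<subseteq> UT3_identities"
    by (auto simp: UT3_identities_def reflection_evaluate[symmetric])
      (simp add: ut3_zero reflection_ut3)
  show "\<forall>\<phi>. graded_star_endomorphism \<phi> \<longrightarrow>
      \<phi> ` UT3_identities \<subseteq> (UT3_identities :: 'a free_algebra set)"
  proof (intro allI impI image_subsetI)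
    fix \<phi> :: "'a free_algebra \<Rightarrow> 'a free_algebra" and p :: "'a free_algebra"
    assume \<phi>: "graded_star_endomorphism \<phi>" and p: "p \<in> UT3_identities"
    have "evaluate \<sigma> (\<phi> p) = 0" if "admissible \<sigma>" for \<sigma>
      using p admissible_endomorphism[OF \<phi> that]
      unfolding UT3_identities_def evaluate_endomorphism[OF \<phi>, of \<sigma> p] by blast
    then show "\<phi> p \<in> UT3_identities"
      by (simp add: UT3_identities_def)
  qed
qed (auto simp: UT3_identities_def evaluate_simps matr.mul_zero_left matr.mul_zero_right)

section \<open>The values of letters in coordinates, and the basis polynomials as identities\<close>

lemma eq_neg_self_char_0: "x = - x \<Longrightarrow> x = (0::'a::field_char_0)"
  by (metis add.right_inverse mult_2 mult_eq_0_iff zero_neq_numeral)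

lemma admissible_Y_Sym:
  assumes "admissible \<sigma>" obtains a b c where "\<sigma> (Y Sym n) = ut3 a b a 0 0 c"
proof -
  have *: "\<sigma> (Y Sym n) \<in> UT3_component 0" "reflection (\<sigma> (Y Sym n)) = \<sigma> (Y Sym n)"
    using assms by (simp_all add: admissible_def)
  from *(1) obtain a b c r where eq: "\<sigma> (Y Sym n) = ut3 a b c 0 0 r"
    by (rule UT3_component_0E)
  from *(2) have "c = a"
    using eq_neg_self_char_0 unfolding eq reflection_ut3 ut3_uminus ut3_eq_iff by blast
  then show ?thesis
    using that eq by blast
qed

text \<open>The reflection fixes the entries (2,2) and (1,3), so both vanish on a skew matrix
  because 2 is invertible. Corner parameters therefore belong to symmetric letters only.\<close>

lemma admissible_Y_Skew:
  assumes "admissible \<sigma>" obtains d where "\<sigma> (Y Skew n) = ut3 d 0 (- d) 0 0 0"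
proof -
  have *: "\<sigma> (Y Skew n) \<in> UT3_component 0" "reflection (\<sigma> (Y Skew n)) = - \<sigma> (Y Skew n)"
    using assms by (simp_all add: admissible_def)
  from *(1) obtain a b c r where eq: "\<sigma> (Y Skew n) = ut3 a b c 0 0 r"
    by (rule UT3_component_0E)
  from *(2) have "b = 0 \<and> c = - a \<and> r = 0"
    using eq_neg_self_char_0 unfolding eq reflection_ut3 ut3_uminus ut3_eq_iff by blast
  then show ?thesis
    using that eq by blast
qed

lemma admissible_Z_Sym:
  assumes "admissible \<sigma>" obtains e where "\<sigma> (Z Sym n) = ut3 0 0 0 e e 0"
proof -
  have *: "\<sigma> (Z Sym n) \<in> UT3_component 1" "reflection (\<sigma> (Z Sym n)) = \<sigma> (Z Sym n)"
    using assms by (simp_all add: admissible_def)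
  from *(1) obtain p q where eq: "\<sigma> (Z Sym n) = ut3 0 0 0 p q 0"
    by (rule UT3_component_1E)
  from *(2) have "q = p"
    using eq_neg_self_char_0 unfolding eq reflection_ut3 ut3_uminus ut3_eq_iff by blast
  then show ?thesis
    using that eq by blast
qed

lemma admissible_Z_Skew:
  assumes "admissible \<sigma>" obtains e where "\<sigma> (Z Skew n) = ut3 0 0 0 e (- e) 0"
proof -
  have *: "\<sigma> (Z Skew n) \<in> UT3_component 1" "reflection (\<sigma> (Z Skew n)) = - \<sigma> (Z Skew n)"
    using assms by (simp_all add: admissible_def)
  from *(1) obtain p q where eq: "\<sigma> (Z Skew n) = ut3 0 0 0 p q 0"
    by (rule UT3_component_1E)
  from *(2) have "q = - p"
    using eq_neg_self_char_0 unfolding eq reflection_ut3 ut3_uminus ut3_eq_iff by blast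
  then show ?thesis
    using that eq by blast
qed

lemma admissible_Z_all:
  assumes "admissible \<sigma>" "x \<in> Z_all" obtains p q where "\<sigma> x = ut3 0 0 0 p q 0"
  using assms(2) that
  by (auto simp: Z_all_def Z_plus_def Z_minus_def
      intro: admissible_Z_Sym[OF assms(1)] admissible_Z_Skew[OF assms(1)])

lemma admissible_UT3:
  assumes "admissible \<sigma>" obtains a b c p q r where "\<sigma> x = ut3 a b c p q r"
proof -
  have "\<sigma> x \<in> UT3"
    using assms UT3_component_imp_UT3 unfolding admissible_iff by blast
  then show ?thesis
    using that by (auto elim!: UT3_obtain)
qed

lemma evaluate_uminus: "evaluate \<sigma> (- p) = - evaluate \<sigma> p"
  using evaluate_simps(2)[of \<sigma> p "- p"] by (simp add: evaluate_simps eq_neg_iff_add_eq_0 add.commute)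

lemma evaluate_diff: "evaluate \<sigma> (p - q) = evaluate \<sigma> p - evaluate \<sigma> q"
  using evaluate_simps(2)[of \<sigma> p "- q"] by (simp add: evaluate_uminus)

lemma basis_polynomials_subset_identities: "basis_polynomials \<subseteq> UT3_identities"
proof
  fix f :: "'a free_algebra"
  assume f: "f \<in> basis_polynomials"
  have "evaluate \<sigma> f = 0" if \<sigma>: "admissible \<sigma>" for \<sigma>
  proof -
    note elims = admissible_Y_Sym[OF \<sigma>] admissible_Y_Skew[OF \<sigma>] admissible_Z_Sym[OF \<sigma>]
      admissible_Z_Skew[OF \<sigma>] admissible_Z_all[OF \<sigma>]
    have Yp: "\<exists>a b c. \<sigma> x = ut3 a b a 0 0 c" if "x \<in> Y_plus" for x
      using that unfolding Y_plus_def by (auto intro: elims(1))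
    have Ym: "\<exists>d. \<sigma> x = ut3 d 0 (- d) 0 0 0" if "x \<in> Y_minus" for x
      using that unfolding Y_minus_def by (auto intro: elims(2))
    have Zp: "\<exists>e. \<sigma> x = ut3 0 0 0 e e 0" if "x \<in> Z_plus" for x
      using that unfolding Z_plus_def by (auto intro: elims(3))
    have Zm: "\<exists>e. \<sigma> x = ut3 0 0 0 e (- e) 0" if "x \<in> Z_minus" for x
      using that unfolding Z_minus_def by (auto intro: elims(4))
    have Za: "\<exists>p q. \<sigma> x = ut3 0 0 0 p q 0" if "x \<in> Z_all" for x
      using that by (auto intro: elims(5))
    have all: "\<exists>a b c p q r. \<sigma> x = ut3 a b c p q r" for x
      by (rule admissible_UT3[OF \<sigma>, of x]) blast
    note ev = evaluate_simps evaluate_diff commutator_def ut3_mult ut3_add ut3_zero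
      ut3_eq_iff algebra_simps
    from f show ?thesis
    proof cases
      \<comment> \<open>The middle letter is unrestricted, so only the triangular shape of its value
        is available.\<close>
      case (id1 A x1 x3 x2)
      from all[of x2] obtain a b c p q r where x2: "\<sigma> x2 = ut3 a b c p q r" by blast
      from id1 consider (ym) "x1 \<in> Y_minus" "x3 \<in> Y_minus" | (zp) "x1 \<in> Z_plus" "x3 \<in> Z_plus"
        | (zm) "x1 \<in> Z_minus" "x3 \<in> Z_minus" by blast
      then show ?thesis
      proof cases
        case ym
        from Ym[OF ym(1)] Ym[OF ym(2)] x2 show ?thesis
          unfolding id1(1) by (elim exE) (simp add: ev)
      next
        case zp
        from Zp[OF zp(1)] Zp[OF zp(2)] x2 show ?thesis
          unfolding id1(1) by (elim exE) (simp add: ev)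
      next
        case zm
        from Zm[OF zm(1)] Zm[OF zm(2)] x2 show ?thesis
          unfolding id1(1) by (elim exE) (simp add: ev)
      qed
    next
      case (id3 A x1 x2)
      from id3 consider (ym) "x1 \<in> Y_minus" "x2 \<in> Y_minus" | (zp) "x1 \<in> Z_plus" "x2 \<in> Z_plus"
        | (zm) "x1 \<in> Z_minus" "x2 \<in> Z_minus" | (yp) "x1 \<in> Y_plus" "x2 \<in> Y_plus" by blast
      then show ?thesis
      proof cases
        case yp
        from Yp[OF yp(1)] Yp[OF yp(2)] show ?thesis
          unfolding id3(1) by (elim exE) (simp add: ev)
      next
        case ym
        from Ym[OF ym(1)] Ym[OF ym(2)] show ?thesis
          unfolding id3(1) by (elim exE) (simp add: ev)
      next
        case zp
        from Zp[OF zp(1)] Zp[OF zp(2)] show ?thesis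
          unfolding id3(1) by (elim exE) (simp add: ev)
      next
        case zm
        from Zm[OF zm(1)] Zm[OF zm(2)] show ?thesis
          unfolding id3(1) by (elim exE) (simp add: ev)
      qed
    next
      case (id2 z1 z2 z3)
      from Za[OF id2(2)] Za[OF id2(3)] Za[OF id2(4)] show ?thesis
        unfolding id2(1) by (elim exE) (simp add: ev)
    next
      case (id4 y1 y2 x3 x4)
      from Yp[OF id4(2)] Ym[OF id4(3)] all[of x3] all[of x4] show ?thesis
        unfolding id4(1) by (elim exE) (simp add: ev)
    next
      case (id5 y1 z1 z2)
      from Yp[OF id5(2)] Za[OF id5(3)] Za[OF id5(4)] show ?thesis
        unfolding id5(1) by (elim exE) (simp add: ev)
    next
      case (id6_left y1 y2 z3)
      from Yp[OF id6_left(2)] Ym[OF id6_left(3)] Za[OF id6_left(4)] show ?thesis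
        unfolding id6_left(1) by (elim exE) (simp add: ev)
    next
      case (id6_right y1 y2 z3)
      from Yp[OF id6_right(2)] Ym[OF id6_right(3)] Za[OF id6_right(4)] show ?thesis
        unfolding id6_right(1) by (elim exE) (simp add: ev)
    next
      case (id7 y1 y2 y3)
      from Yp[OF id7(2)] Ym[OF id7(3)] Ym[OF id7(4)] show ?thesis
        unfolding id7(1) by (elim exE) (simp add: ev)
    next
      case (id8 y1 y2 z1)
      from Ym[OF id8(2)] Ym[OF id8(3)] Za[OF id8(4)] show ?thesis
        unfolding id8(1) by (elim exE) (simp add: ev)
    next
      case (id9 z1 z2 y1)
      from Za[OF id9(2)] Za[OF id9(3)] Ym[OF id9(4)] show ?thesis
        unfolding id9(1) by (elim exE) (simp add: ev)
    next
      case (id10 z1 z2)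
      from Zp[OF id10(2)] Zm[OF id10(3)] show ?thesis
        unfolding id10(1) by (elim exE) (simp add: ev)
    next
      case (id11 z1 z2 y1)
      from Za[OF id11(2)] Za[OF id11(3)] Ym[OF id11(4)] show ?thesis
        unfolding id11(1) by (elim exE) (simp add: ev)
    qed
  qed
  then show "f \<in> UT3_identities"
    by (simp add: UT3_identities_def)
qed

lemma graded_star_T_ideal_Inter:
  assumes "\<And>I. I \<in> \<I> \<Longrightarrow> graded_star_T_ideal I"
  shows "graded_star_T_ideal (\<Inter>\<I>)"
  unfolding graded_star_T_ideal_def two_sided_ideal_def
proof (intro conjI ballI allI impI image_subsetI InterI)
  fix I p q and \<phi> :: "'a free_algebra \<Rightarrow> 'a free_algebra"
  assume I: "I \<in> \<I>"
  note T = assms[OF I, unfolded graded_star_T_ideal_def two_sided_ideal_def]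
  show "0 \<in> I"
    using T by simp
  assume "p \<in> \<Inter>\<I>"
  then have p: "p \<in> I"
    using I by simp
  show "q * p \<in> I" "p * q \<in> I"
    using T p by simp_all
  show "free_star p \<in> I" "graded_star_endomorphism \<phi> \<Longrightarrow> \<phi> p \<in> I"
    using T p by blast+
  assume "q \<in> \<Inter>\<I>"
  then show "p + q \<in> I"
    using T p I by simp
qed

lemma graded_star_T_ideal_generated: "graded_star_T_ideal (generated_T_ideal S)"
  unfolding generated_T_ideal_def by (rule graded_star_T_ideal_Inter) simp

lemma generated_T_ideal_superset: "S \<subseteq> generated_T_ideal S"
  by (auto simp: generated_T_ideal_def)

lemma generated_T_ideal_least:
  "graded_star_T_ideal I \<Longrightarrow> S \<subseteq> I \<Longrightarrow> generated_T_ideal S \<subseteq> I"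
  by (auto simp: generated_T_ideal_def)

lemma generated_subset_identities: "generated_T_ideal basis_polynomials \<subseteq> UT3_identities"
  using generated_T_ideal_least graded_star_T_ideal_UT3_identities
    basis_polynomials_subset_identities by blast

section \<open>Evaluation at generic matrices\<close>

definition monomial_value :: "('p \<Rightarrow> 'a) \<Rightarrow> 'p multiset \<Rightarrow> 'a::field_char_0" where
  "monomial_value t m = prod_mset (image_mset t m)"

lemma monomial_value_simps [simp]:
  "monomial_value t {#} = 1" "monomial_value t (add_mset p m) = t p * monomial_value t m"
  by (simp_all add: monomial_value_def)

text \<open>Multiplicativity in the point, not in the multiset: this makes a monomial a character of
  the monoid of points.\<close>

lemma monomial_value_mult: "monomial_value (\<lambda>p. s p * t p) m = monomial_value s m * monomial_value t m"
  by (induction m) (simp_all add: algebra_simps)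

lemma monomial_value_separates:
  assumes "m \<noteq> n"
  shows "\<exists>t. monomial_value t m \<noteq> (monomial_value t n :: 'a::field_char_0)"
proof -
  obtain p where p: "count m p \<noteq> count n p"
    using assms by (auto simp: multiset_eq_iff)
  \<comment> \<open>At this point a monomial takes the value of a power of 2 whose exponent is the
    multiplicity of \<open>p\<close>; distinct powers of 2 stay distinct in characteristic
    zero.\<close>
  define t :: "_ \<Rightarrow> 'a" where "t = (\<lambda>q. if q = p then 2 else 1)"
  have t: "monomial_value t k = of_nat (2 ^ count k p)" for k
    by (induction k) (auto simp: t_def)
  have "monomial_value t m \<noteq> monomial_value t n"
    unfolding t of_nat_eq_iff using p by simp
  then show ?thesis
    by blast
qed

text \<open>Dedekind's independence of characters, the characters being the monomials.\<close>

lemma monomial_values_independent: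
  fixes h :: "'p multiset \<Rightarrow> 'a::field_char_0"
  assumes "finite S" "\<And>t. (\<Sum>m\<in>S. h m * monomial_value t m) = 0" "m \<in> S"
  shows "h m = 0"
  using assms
proof (induction S arbitrary: h m rule: finite_induct)
  case (insert n S)
  have S: "h k = 0" if k: "k \<in> S" for k
  proof -
    from k insert.hyps have "k \<noteq> n" by blast
    then obtain s :: "'p \<Rightarrow> 'a" where s: "monomial_value s k \<noteq> monomial_value s n"
      using monomial_value_separates by blast
    have "(\<Sum>m\<in>S. (h m * (monomial_value s m - monomial_value s n)) * monomial_value t m) = 0" for t
    proof -
      have "0 = (\<Sum>m\<in>insert n S. h m * monomial_value (\<lambda>p. s p * t p) m) -
          monomial_value s n * (\<Sum>m\<in>insert n S. h m * monomial_value t m)"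
        using insert.prems(1) by simp
      also have "\<dots> = (\<Sum>m\<in>S. (h m * (monomial_value s m - monomial_value s n)) * monomial_value t m)"
        using insert.hyps
        by (simp add: monomial_value_mult sum_distrib_left sum_subtractf algebra_simps)
      finally show ?thesis by simp
    qed
    from insert.IH[OF this k] s show ?thesis by simp
  qed
  then have "h n * monomial_value (\<lambda>_. 1) n = 0"
    using insert.prems(1)[of "\<lambda>_. 1"] insert.hyps by simp
  then have "h n = 0"
    by (simp add: monomial_value_def)
  with S insert.prems(2) show ?case by blast
qed simp

text \<open>Terms with equal monomials are collected first, and then independence applies. Values
  outside the image of \<open>M\<close> are allowed, so that callers need not know which monomials
  occur.\<close>

lemma monomial_fibre_sum:
  fixes g :: "'k \<Rightarrow> 'a::field_char_0" and M :: "'k \<Rightarrow> 'p multiset"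
  assumes K: "finite K" and 0: "\<And>t. (\<Sum>k\<in>K. g k * monomial_value t (M k)) = 0"
  shows "(\<Sum>k\<in>{k\<in>K. M k = m}. g k) = 0"
proof (cases "m \<in> M ` K")
  case True
  have "(\<Sum>m\<in>M ` K. (\<Sum>k\<in>{k\<in>K. M k = m}. g k) * monomial_value t m) = 0" for t
  proof -
    have "(\<Sum>m\<in>M ` K. (\<Sum>k\<in>{k\<in>K. M k = m}. g k) * monomial_value t m) =
        (\<Sum>m\<in>M ` K. \<Sum>k\<in>{k\<in>K. M k = m}. g k * monomial_value t (M k))"
      by (simp add: sum_distrib_right)
    also have "\<dots> = (\<Sum>k\<in>K. g k * monomial_value t (M k))"
      by (rule sum.image_gen[OF K, symmetric])
    finally show ?thesis
      using 0 by simp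
  qed
  from monomial_values_independent[OF finite_imageI[OF K] this True] show ?thesis .
next
  case False
  then have "{k\<in>K. M k = m} = {}" by auto
  then show ?thesis by (simp only: sum.empty)
qed

section \<open>Generic matrices and the monomials of words\<close>

fun is_Z :: "indet \<Rightarrow> bool" where
  "is_Z (Y _ _) = False"
| "is_Z (Z _ _) = True"

definition Y_word :: "indet list \<Rightarrow> bool" where
  "Y_word w \<longleftrightarrow> (\<forall>x\<in>set w. \<not> is_Z x)"

lemma Y_word_simps [simp]:
  "Y_word []" "Y_word (x # w) \<longleftrightarrow> \<not> is_Z x \<and> Y_word w"
  "Y_word (u @ v) \<longleftrightarrow> Y_word u \<and> Y_word v"
  by (auto simp: Y_word_def)

text \<open>With the parameters of the corner \<open>E\<^sub>1\<^sub>3\<close> set to zero, the \<open>i\<close>-th row of the value of a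
  word at generic matrices has at most one nonzero entry; that entry is \<open>row1\<close>, \<open>row2\<close> or \<open>row3\<close>, a sign or zero,
  times a monomial. The flag in \<open>monomial\<close> tells whether the current row is an outer one or the
  middle one; every letter of degree one toggles it. Symmetric letters of degree zero have
  separate parameters for the outer and the middle diagonal entries.\<close>

fun row3 :: "indet list \<Rightarrow> int" where
  "row3 [] = 1"
| "row3 (Y Sym n # w) = row3 w"
| "row3 (Y Skew n # w) = - row3 w"
| "row3 (Z s n # w) = 0"

fun row2 :: "indet list \<Rightarrow> int" where
  "row2 [] = 1"
| "row2 (Y Sym n # w) = row2 w"
| "row2 (Y Skew n # w) = 0"
| "row2 (Z Sym n # w) = row3 w"
| "row2 (Z Skew n # w) = - row3 w"

fun row1 :: "indet list \<Rightarrow> int" where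
  "row1 [] = 1"
| "row1 (Y s n # w) = row1 w"
| "row1 (Z s n # w) = row2 w"

primrec monomial :: "bool \<Rightarrow> indet list \<Rightarrow> (bool \<times> indet) multiset" where
  "monomial p [] = {#}"
| "monomial p (x # w) = (if is_Z x then add_mset (True, x) (monomial (\<not> p) w)
     else add_mset (p, x) (monomial p w))"

text \<open>The corner parameters \<open>c\<close> are kept apart from \<open>t\<close> because they
  never enter a monomial: they are set to zero or to the indicator of one index.\<close>

fun generic :: "(bool \<times> indet \<Rightarrow> 'a) \<Rightarrow> (nat \<Rightarrow> 'a) \<Rightarrow> indet \<Rightarrow> 'a::field_char_0 ^ 3 ^ 3" where
  "generic t c (Y Sym n) =
     ut3 (t (True, Y Sym n)) (t (False, Y Sym n)) (t (True, Y Sym n)) 0 0 (c n)"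
| "generic t c (Y Skew n) = ut3 (t (True, Y Skew n)) 0 (- t (True, Y Skew n)) 0 0 0"
| "generic t c (Z s n) = ut3 0 0 0 (t (True, Z s n)) (symmetry_sign s * t (True, Z s n)) 0"

lemma admissible_generic: "admissible (generic t c)"
  by (simp add: admissible_def ut3_component_0 ut3_component_1 reflection_ut3 ut3_uminus)

lemma ut3_mult_nth:
  "(ut3 a b c p q r ** A) $ 1 $ j = a * A $ 1 $ j + p * A $ 2 $ j + r * A $ 3 $ j"
  "(ut3 a b c p q r ** A) $ 2 $ j = b * A $ 2 $ j + q * A $ 3 $ j"
  "(ut3 a b c p q r ** A) $ 3 $ j = c * A $ 3 $ j"
  by (simp_all add: matrix_matrix_mult_def sum_3)

text \<open>Without corner parameters each generic letter has at most one nonzero entry per row, so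
  a row of a product follows a single path. Summing over the row picks out its only possible nonzero
  entry without naming the column, which depends on the word.\<close>

lemma generic_row_sums:
  fixes t :: "bool \<times> indet \<Rightarrow> 'a::field_char_0"
  defines "A \<equiv> matr.word_value (generic t (\<lambda>_. 0))"
  shows "(\<Sum>j\<in>UNIV. A w $ 1 $ j) = of_int (row1 w) * monomial_value t (monomial True w)"
    and "(\<Sum>j\<in>UNIV. A w $ 2 $ j) = of_int (row2 w) * monomial_value t (monomial False w)"
    and "(\<Sum>j\<in>UNIV. A w $ 3 $ j) = of_int (row3 w) * monomial_value t (monomial True w)"
proof (induction w)
  case Nil
  have "A [] = ut3 1 1 1 0 0 0"
    unfolding mat_eq_ut3[symmetric] by (simp add: A_def)
  then show "(\<Sum>j\<in>UNIV. A [] $ 1 $ j) = of_int (row1 []) * monomial_value t (monomial True [])"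
    and "(\<Sum>j\<in>UNIV. A [] $ 2 $ j) = of_int (row2 []) * monomial_value t (monomial False [])"
    and "(\<Sum>j\<in>UNIV. A [] $ 3 $ j) = of_int (row3 []) * monomial_value t (monomial True [])"
    by (simp_all add: sum_3)
next
  case (Cons x w)
  obtain s n where x: "x = Y s n \<or> x = Z s n"
    by (cases x) auto
  have step: "A (x # w) = generic t (\<lambda>_. 0) x ** A w"
    by (simp add: A_def)
  note simps = step ut3_mult_nth sum.distrib sum_negf sum_distrib_left[symmetric] Cons.IH
  from x show "(\<Sum>j\<in>UNIV. A (x # w) $ 1 $ j) =
      of_int (row1 (x # w)) * monomial_value t (monomial True (x # w))"
    by (cases s) (auto simp: simps)
  from x show "(\<Sum>j\<in>UNIV. A (x # w) $ 2 $ j) =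
      of_int (row2 (x # w)) * monomial_value t (monomial False (x # w))"
    by (cases s) (auto simp: simps)
  from x show "(\<Sum>j\<in>UNIV. A (x # w) $ 3 $ j) =
      of_int (row3 (x # w)) * monomial_value t (monomial True (x # w))"
    by (cases s) (auto simp: simps)
qed

lemma evaluate_nth:
  "evaluate \<sigma> f $ i $ j =
     (\<Sum>w\<in>Poly_Mapping.keys f. Poly_Mapping.lookup f w * matr.word_value \<sigma> w $ i $ j)"
  by (simp add: evaluate_eq_extension matr.extension_def mat_scalar_mult)

lemma evaluate_row_sum:
  "(\<Sum>j\<in>UNIV. evaluate \<sigma> f $ i $ j) =
     (\<Sum>w\<in>Poly_Mapping.keys f. Poly_Mapping.lookup f w *
        (\<Sum>j\<in>UNIV. matr.word_value \<sigma> w $ i $ j))"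
  unfolding evaluate_nth sum_distrib_left by (rule sum.swap)

lemma identity_row_sum1:
  assumes f: "f \<in> UT3_identities"
  shows "(\<Sum>w\<in>{w\<in>Poly_Mapping.keys f. monomial True w = m}.
    Poly_Mapping.lookup f w * of_int (row1 w)) = 0"
proof (rule monomial_fibre_sum[OF finite_keys])
  fix t
  have "evaluate (generic t (\<lambda>_. 0)) f = 0"
    using f admissible_generic by (auto simp: UT3_identities_def)
  from arg_cong[OF this, of "\<lambda>A. \<Sum>j\<in>UNIV. A $ 1 $ j"]
  show "(\<Sum>w\<in>Poly_Mapping.keys f. Poly_Mapping.lookup f w * of_int (row1 w) *
      monomial_value t (monomial True w)) = 0"
    by (simp add: evaluate_row_sum generic_row_sums mult.assoc)
qed

lemma identity_row_sum2:
  assumes f: "f \<in> UT3_identities"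
  shows "(\<Sum>w\<in>{w\<in>Poly_Mapping.keys f. monomial False w = m}.
    Poly_Mapping.lookup f w * of_int (row2 w)) = 0"
proof (rule monomial_fibre_sum[OF finite_keys])
  fix t
  have "evaluate (generic t (\<lambda>_. 0)) f = 0"
    using f admissible_generic by (auto simp: UT3_identities_def)
  from arg_cong[OF this, of "\<lambda>A. \<Sum>j\<in>UNIV. A $ 2 $ j"]
  show "(\<Sum>w\<in>Poly_Mapping.keys f. Poly_Mapping.lookup f w * of_int (row2 w) *
      monomial_value t (monomial False w)) = 0"
    by (simp add: evaluate_row_sum generic_row_sums mult.assoc)
qed

text \<open>For the parameters \<open>c\<close> concentrated at the index \<open>i\<close>, the corner entry of a word in \<open>Y\<close>
  becomes \<open>corner i\<close> times a monomial when it is multiplied by the diagonal parameter of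
  \<open>Y Sym i\<close>.\<close>

primrec corner :: "nat \<Rightarrow> indet list \<Rightarrow> int" where
  "corner i [] = 0"
| "corner i (x # w) = (if x = Y Sym i then row3 w else 0) + corner i w"

text \<open>Letters of degree one are sent to zero, which isolates the words in \<open>Y\<close>.
  Outer and middle parameters are identified, so monomials are simply multisets of letters.\<close>

definition generic_Y :: "(indet \<Rightarrow> 'a) \<Rightarrow> nat \<Rightarrow> indet \<Rightarrow> 'a::field_char_0 ^ 3 ^ 3" where
  "generic_Y t i = generic (\<lambda>(_, x). if is_Z x then 0 else t x) (\<lambda>n. if n = i then 1 else 0)"

lemma generic_Y_word:
  fixes t :: "indet \<Rightarrow> 'a::field_char_0" and i :: nat
  defines "A \<equiv> matr.word_value (generic_Y t i)"
  assumes "Y_word w"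
  shows "A w $ 1 $ 1 = monomial_value t (mset w) \<and>
    A w $ 3 $ 3 = of_int (row3 w) * monomial_value t (mset w) \<and>
    t (Y Sym i) * A w $ 1 $ 3 = of_int (corner i w) * monomial_value t (mset w)"
  using assms(2)
proof (induction w)
  case Nil
  have "A [] = ut3 1 1 1 0 0 0"
    unfolding mat_eq_ut3[symmetric] by (simp add: A_def)
  then show ?case
    by simp
next
  case (Cons x w)
  then have IH: "A w $ 1 $ 1 = monomial_value t (mset w)"
    "A w $ 3 $ 3 = of_int (row3 w) * monomial_value t (mset w)"
    "t (Y Sym i) * (a * A w $ 1 $ 3) = a * (of_int (corner i w) * monomial_value t (mset w))"
    for a
    by (simp_all add: mult.left_commute)
  obtain s n where x: "x = Y s n"
    using Cons.prems by (cases x) auto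
  have step: "A (y # w) = generic_Y t i y ** A w" for y
    by (simp add: A_def)
  have "A w $ 2 $ 1 = 0" "A w $ 3 $ 1 = 0"
    using word_value_component[of "generic_Y t i" w]
    by (simp_all add: A_def generic_Y_def admissible_generic UT3_component_def UT3_def)
  then show ?case
    by (cases s) (auto simp: step generic_Y_def ut3_mult_nth x IH distrib_left distrib_right)
qed

lemma generic_Y_word_zero: "\<not> Y_word w \<Longrightarrow> matr.word_value (generic_Y t i) w = 0"
proof (induction w)
  case (Cons x w)
  have "is_Z x \<Longrightarrow> generic_Y t i x = 0"
    by (cases x) (simp_all add: generic_Y_def ut3_zero)
  then show ?case
    using Cons by (auto simp: matr.mul_zero_left matr.mul_zero_right)
qed simp

lemma identity_Y_words:
  assumes f: "f \<in> UT3_identities"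
  shows "(\<Sum>w\<in>{w\<in>{w\<in>Poly_Mapping.keys f. Y_word w}. mset w = m}. Poly_Mapping.lookup f w) = 0"
    and "(\<Sum>w\<in>{w\<in>{w\<in>Poly_Mapping.keys f. Y_word w}. mset w = m}.
      Poly_Mapping.lookup f w * of_int (corner i w)) = 0"
proof -
  have fin: "finite {w\<in>Poly_Mapping.keys f. Y_word w}"
    by simp
  have entry: "(\<Sum>w\<in>{w\<in>Poly_Mapping.keys f. Y_word w}.
      Poly_Mapping.lookup f w * matr.word_value (generic_Y t i) w $ k $ l) = 0" for t i k l
  proof -
    have "evaluate (generic_Y t i) f = 0"
      using f admissible_generic by (auto simp: UT3_identities_def generic_Y_def)
    then have "0 = (\<Sum>w\<in>Poly_Mapping.keys f.
        Poly_Mapping.lookup f w * matr.word_value (generic_Y t i) w $ k $ l)"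
      unfolding evaluate_nth[symmetric] by simp
    also have "\<dots> = (\<Sum>w\<in>{w\<in>Poly_Mapping.keys f. Y_word w}.
        Poly_Mapping.lookup f w * matr.word_value (generic_Y t i) w $ k $ l)"
      by (rule sum.mono_neutral_right) (auto simp: generic_Y_word_zero)
    finally show ?thesis by simp
  qed
  show "(\<Sum>w\<in>{w\<in>{w\<in>Poly_Mapping.keys f. Y_word w}. mset w = m}. Poly_Mapping.lookup f w) = 0"
  proof (rule monomial_fibre_sum[OF fin])
    fix t
    show "(\<Sum>w\<in>{w\<in>Poly_Mapping.keys f. Y_word w}.
        Poly_Mapping.lookup f w * monomial_value t (mset w)) = 0"
      \<comment> \<open>Index 0 is an arbitrary choice: the (1,1) entry does not depend on the
        corner parameters.\<close>
      using entry[of t 0 1 1] by (simp add: generic_Y_word[THEN conjunct1])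
  qed
  show "(\<Sum>w\<in>{w\<in>{w\<in>Poly_Mapping.keys f. Y_word w}. mset w = m}.
      Poly_Mapping.lookup f w * of_int (corner i w)) = 0"
  proof (rule monomial_fibre_sum[OF fin])
    fix t
    have "(\<Sum>w\<in>{w\<in>Poly_Mapping.keys f. Y_word w}.
        Poly_Mapping.lookup f w * of_int (corner i w) * monomial_value t (mset w)) =
      (\<Sum>w\<in>{w\<in>Poly_Mapping.keys f. Y_word w}.
        t (Y Sym i) * (Poly_Mapping.lookup f w * matr.word_value (generic_Y t i) w $ 1 $ 3))"
    proof (rule sum.cong[OF refl])
      fix w
      assume "w \<in> {w\<in>Poly_Mapping.keys f. Y_word w}"
      then have "of_int (corner i w) * monomial_value t (mset w) =
          t (Y Sym i) * matr.word_value (generic_Y t i) w $ 1 $ 3"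
        by (simp add: generic_Y_word)
      then show "Poly_Mapping.lookup f w * of_int (corner i w) * monomial_value t (mset w) =
          t (Y Sym i) * (Poly_Mapping.lookup f w * matr.word_value (generic_Y t i) w $ 1 $ 3)"
        by (simp only: mult.assoc) (simp only: mult.left_commute)
    qed
    also have "\<dots> = 0"
      by (simp only: sum_distrib_left[symmetric] entry mult_zero_right)
    finally show "(\<Sum>w\<in>{w\<in>Poly_Mapping.keys f. Y_word w}.
        Poly_Mapping.lookup f w * of_int (corner i w) * monomial_value t (mset w)) = 0" .
  qed
qed

section \<open>The relatively free algebra\<close>

abbreviation basis_ideal :: "'a::field_char_0 free_algebra set" where
  "basis_ideal \<equiv> generated_T_ideal basis_polynomials"

definition basis_congruent :: "'a::field_char_0 free_algebra \<Rightarrow> 'a free_algebra \<Rightarrow> bool" where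
  "basis_congruent p q \<longleftrightarrow> p - q \<in> basis_ideal"

lemma basis_ideal_closed:
  "0 \<in> basis_ideal"
  "p \<in> basis_ideal \<Longrightarrow> q \<in> basis_ideal \<Longrightarrow> p + q \<in> basis_ideal"
  "p \<in> basis_ideal \<Longrightarrow> q * p \<in> basis_ideal"
  "p \<in> basis_ideal \<Longrightarrow> p * q \<in> basis_ideal"
  "p \<in> basis_ideal \<Longrightarrow> free_star p \<in> basis_ideal"
  "p \<in> basis_ideal \<Longrightarrow> graded_star_endomorphism \<phi> \<Longrightarrow> \<phi> p \<in> basis_ideal"
  using graded_star_T_ideal_generated[of basis_polynomials]
  unfolding graded_star_T_ideal_def two_sided_ideal_def by blast+

lemma basis_ideal_uminus: "p \<in> basis_ideal \<Longrightarrow> - p \<in> basis_ideal"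
  using basis_ideal_closed(3)[of p "- 1"] by simp

lemma equivp_basis_congruent: "equivp basis_congruent"
proof (rule equivpI)
  show "reflp basis_congruent"
    by (simp add: reflp_def basis_congruent_def basis_ideal_closed)
  show "symp basis_congruent"
    using basis_ideal_uminus by (fastforce simp: symp_def basis_congruent_def)
  show "transp basis_congruent"
    using basis_ideal_closed(2) by (fastforce simp: transp_def basis_congruent_def)
qed

text \<open>Keeps \<open>transfer\<close> from descending further, to the functions that represent polynomials.\<close>

lifting_forget poly_mapping.lifting

quotient_type (overloaded) 'a rel_free = "'a::field_char_0 free_algebra" / basis_congruent
  by (rule equivp_basis_congruent)

lemma basis_congruent_add:
  assumes "basis_congruent p p'" "basis_congruent q q'"
  shows "basis_congruent (p + q) (p' + q')"
proof -
  have "(p + q) - (p' + q') = (p - p') + (q - q')"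
    by simp
  then show ?thesis
    using assms by (simp only: basis_congruent_def basis_ideal_closed)
qed

lemma basis_congruent_uminus:
  assumes "basis_congruent p p'"
  shows "basis_congruent (- p) (- p')"
  using basis_ideal_uminus[of "p - p'"] assms by (simp add: basis_congruent_def)

lemma basis_congruent_mult:
  assumes "basis_congruent p p'" "basis_congruent q q'"
  shows "basis_congruent (p * q) (p' * q')"
proof -
  have "p * q - p' * q' = (p - p') * q + p' * (q - q')"
    by (simp add: algebra_simps)
  then show ?thesis
    using assms by (simp only: basis_congruent_def basis_ideal_closed)
qed

text \<open>The class \<open>ring_1\<close> demands a nontrivial quotient. The zero assignment is
  admissible and does not kill 1, so 1 is no identity.\<close>

lemma one_not_in_basis_ideal: "(1 :: 'a::field_char_0 free_algebra) \<notin> basis_ideal"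
proof
  assume "(1 :: 'a free_algebra) \<in> basis_ideal"
  then have "(1 :: 'a free_algebra) \<in> UT3_identities"
    using generated_subset_identities by blast
  moreover have "admissible (\<lambda>_. 0 :: 'a ^ 3 ^ 3)"
    by (simp add: admissible_iff UT3_component_zero matr.mul_zero_right)
      (simp add: ut3_zero reflection_ut3)
  ultimately have "mat 1 = (0 :: 'a ^ 3 ^ 3)"
    by (auto simp: UT3_identities_def evaluate_simps)
  then show False
    by (simp add: mat_eq_ut3 ut3_zero ut3_eq_iff)
qed

lemma minus_one_not_in_basis_ideal: "- (1 :: 'a::field_char_0 free_algebra) \<notin> basis_ideal"
  using basis_ideal_uminus[of "- 1"] one_not_in_basis_ideal by auto

instantiation rel_free :: (field_char_0) ring_1
begin

lift_definition zero_rel_free :: "'a rel_free" is 0 .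
lift_definition one_rel_free :: "'a rel_free" is 1 .
lift_definition plus_rel_free :: "'a rel_free \<Rightarrow> 'a rel_free \<Rightarrow> 'a rel_free" is "(+)"
  by (rule basis_congruent_add)
lift_definition uminus_rel_free :: "'a rel_free \<Rightarrow> 'a rel_free" is uminus
  by (rule basis_congruent_uminus)
lift_definition minus_rel_free :: "'a rel_free \<Rightarrow> 'a rel_free \<Rightarrow> 'a rel_free" is "(-)"
  using basis_congruent_add basis_congruent_uminus by fastforce
lift_definition times_rel_free :: "'a rel_free \<Rightarrow> 'a rel_free \<Rightarrow> 'a rel_free" is "(*)"
  by (rule basis_congruent_mult)

instance
proof
  fix a b c :: "'a rel_free"
  note eq = equivp_reflp[OF equivp_basis_congruent]
  show "a + b + c = a + (b + c)" "a + b = b + a" "0 + a = a" "- a + a = 0" "a - b = a + - b"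
    by (transfer, simp add: algebra_simps eq)+
  show "a * b * c = a * (b * c)" "(a + b) * c = a * c + b * c" "a * (b + c) = a * b + a * c"
    "1 * a = a" "a * 1 = a"
    by (transfer, simp add: algebra_simps eq)+
  show "(0 :: 'a rel_free) \<noteq> 1"
    by transfer (simp add: basis_congruent_def minus_one_not_in_basis_ideal)
qed

end

lift_definition proj :: "'a::field_char_0 free_algebra \<Rightarrow> 'a rel_free" is "\<lambda>p. p" .

lift_definition rel_star :: "'a::field_char_0 rel_free \<Rightarrow> 'a rel_free" is free_star
  by (auto simp: basis_congruent_def basis_ideal_closed simp flip: free_star_diff)

lemma proj_add: "proj (p + q) = proj p + proj q"
  and proj_diff: "proj (p - q) = proj p - proj q"
  and proj_mult: "proj (p * q) = proj p * proj q"
  and proj_zero: "proj 0 = 0"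
  and proj_one: "proj 1 = 1"
  and rel_star_proj: "rel_star (proj p) = proj (free_star p)"
  by (transfer, simp add: equivp_reflp[OF equivp_basis_congruent])+

lemma proj_eq_0_iff: "proj p = 0 \<longleftrightarrow> p \<in> basis_ideal"
  by transfer (simp add: basis_congruent_def)

lemma proj_surj: "\<exists>p. r = proj p"
  by transfer (use equivp_reflp[OF equivp_basis_congruent] in blast)

lemma rel_star_add: "rel_star (a + b) = rel_star a + rel_star b"
  by (metis proj_surj proj_add rel_star_proj free_star_add)

lemma rel_star_diff: "rel_star (a - b) = rel_star a - rel_star b"
  by (metis proj_surj proj_diff rel_star_proj free_star_diff)

lemma rel_star_mult: "rel_star (a * b) = rel_star b * rel_star a"
  by (metis proj_surj proj_mult rel_star_proj free_star_mult)

lemma rel_star_zero: "rel_star 0 = 0"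
  by (metis proj_zero rel_star_proj free_star_zero)

section \<open>Scalars, degree and symmetry in the quotient\<close>

definition rel_const :: "'a::field_char_0 \<Rightarrow> 'a rel_free" where
  "rel_const c = proj (const c)"

lemma rel_const_add: "rel_const (a + b) = rel_const a + rel_const b"
  by (simp add: rel_const_def const_add proj_add)

lemma rel_const_mult: "rel_const (a * b) = rel_const a * rel_const b"
  by (simp add: rel_const_def const_mult proj_mult)

lemma rel_const_one: "rel_const 1 = 1"
  by (simp add: rel_const_def proj_one)

lemma rel_const_central: "rel_const c * r = r * rel_const c"
  unfolding rel_const_def by (metis proj_surj proj_mult const_central)

interpretation rel: scalar_algebra "(*)" "1 :: 'a::field_char_0 rel_free" rel_const
  by unfold_locales
    (simp_all only: mult.assoc mult_1_left mult_1_right distrib_left distrib_right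
      rel_const_add rel_const_mult rel_const_one, rule rel_const_central)

lemma rel_const_uminus_one: "rel_const (- 1) = - 1"
  using rel_const_add[of "- 1" 1] by (simp add: rel_const_one rel.scal_zero eq_neg_iff_add_eq_0)

definition rel_degree :: "bit \<Rightarrow> 'a::field_char_0 rel_free set" where
  "rel_degree g = proj ` free_component g"

text \<open>The symmetry condition is imposed in the quotient; a given representative need not be
  symmetric or skew.\<close>

definition rel_component :: "bit \<Rightarrow> symmetry \<Rightarrow> 'a::field_char_0 rel_free set" where
  "rel_component g s = {r \<in> rel_degree g. rel_star r = rel_const (symmetry_sign s) * r}"

abbreviation (input) "Yp \<equiv> rel_component 0 Sym"
abbreviation (input) "Ym \<equiv> rel_component 0 Skew"
abbreviation (input) "Zp \<equiv> rel_component 1 Sym"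
abbreviation (input) "Zm \<equiv> rel_component 1 Skew"

lemma rel_degree_add: "a \<in> rel_degree g \<Longrightarrow> b \<in> rel_degree g \<Longrightarrow> a + b \<in> rel_degree g"
  using free_component_add by (fastforce simp: rel_degree_def simp flip: proj_add)

lemma rel_degree_mult: "a \<in> rel_degree g \<Longrightarrow> b \<in> rel_degree h \<Longrightarrow> a * b \<in> rel_degree (g + h)"
  using free_component_mult unfolding rel_degree_def by (fastforce simp flip: proj_mult)

lemma rel_degree_const: "rel_const c \<in> rel_degree 0"
  by (simp add: rel_degree_def rel_const_def free_component_const)

lemma rel_degree_scale: "a \<in> rel_degree g \<Longrightarrow> rel_const c * a \<in> rel_degree g"
  using rel_degree_mult[OF rel_degree_const] by (metis add_0)

lemma rel_degree_diff: "a \<in> rel_degree g \<Longrightarrow> b \<in> rel_degree g \<Longrightarrow> a - b \<in> rel_degree g"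
  using rel_degree_add[of a g "rel_const (- 1) * b"] rel_degree_scale[of b g "- 1"]
  by (simp add: rel_const_uminus_one)

lemma rel_degree_star: "a \<in> rel_degree g \<Longrightarrow> rel_star a \<in> rel_degree g"
  using free_component_star by (fastforce simp: rel_degree_def rel_star_proj)

lemma zero_in_rel_component: "0 \<in> rel_component g s"
  using free_component_zero proj_zero by (force simp: rel_component_def rel_degree_def rel_star_zero)

text \<open>An arbitrary homogeneous representative \<open>q\<close> is replaced by half of
  \<open>q\<close> plus the signed \<open>free_star q\<close>. This has the required symmetry in the
  free algebra and, since the class is already symmetric or skew, the same image.\<close>

lemma rel_component_lift:
  assumes "r \<in> rel_component g s"
  obtains p where "p \<in> free_component g" "free_star p = const (symmetry_sign s) * p" "proj p = r"
proof -
  obtain q where q: "q \<in> free_component g" "r = proj q"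
    using assms by (auto simp: rel_component_def rel_degree_def)
  let ?e = "symmetry_sign s"
  let ?p = "const (1 / 2) * (q + const ?e * free_star q)"
  have e: "const ?e * (const ?e * x) = x" for x :: "'a free_algebra"
    by (simp add: symmetry_sign_square flip: mult.assoc const_mult)
  have "free_star ?p = const (1 / 2) * (free_star q + const ?e * q)"
    by (simp only: free_star_const_mult free_star_add free_star_involutive)
  also have "\<dots> = const (1 / 2) * (const ?e * (q + const ?e * free_star q))"
    by (simp only: distrib_left e add.commute)
  also have "\<dots> = const ?e * ?p"
    by (simp only: mult.assoc[symmetric] const_mult[symmetric] mult.commute[of ?e])
  finally have 1: "free_star ?p = const ?e * ?p" .
  have 2: "?p \<in> free_component g"
    by (intro free_component_const_mult free_component_add free_component_star q)
  have "proj (const ?e * free_star q) = rel_const ?e * (rel_const ?e * r)"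
    using assms by (simp add: proj_mult q rel_star_proj[symmetric] rel_component_def rel_const_def)
  also have "\<dots> = r"
    by (simp add: symmetry_sign_square rel_const_one flip: mult.assoc rel_const_mult)
  finally have "proj ?p = rel_const (1 / 2) * (r + r)"
    by (simp add: proj_mult proj_add rel_const_def q)
  also have "\<dots> = rel_const (1 / 2 + 1 / 2) * r"
    by (simp only: rel_const_add distrib_left distrib_right)
  finally have 3: "proj ?p = r"
    by (simp add: rel_const_one)
  show ?thesis
    using that[OF 2 1 3] .
qed

lemma rel_degree_split:
  assumes "r \<in> rel_degree g"
  obtains a b where "a \<in> rel_component g Sym" "b \<in> rel_component g Skew" "r = a + b"
proof
  let ?h = "rel_const (1 / 2)"
  have inv: "rel_star (rel_star r) = r"
    using proj_surj[of r] by (auto simp: rel_star_proj free_star_involutive)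
  have hs: "rel_star (?h * x) = ?h * rel_star x" for x :: "'a rel_free"
    by (simp add: rel_star_mult rel_const_central[of _ "rel_star x"])
      (simp add: rel_const_def rel_star_proj free_star_const)
  show "?h * (r + rel_star r) \<in> rel_component g Sym"
    by (simp add: rel_component_def hs inv rel_star_add rel_const_one add.commute
        rel_degree_scale rel_degree_add rel_degree_star assms)
  show "?h * (r - rel_star r) \<in> rel_component g Skew"
    by (simp add: rel_component_def hs inv rel_star_diff rel_const_uminus_one
        rel_degree_scale rel_degree_diff rel_degree_star assms algebra_simps)
  have "?h * (r + rel_star r) + ?h * (r - rel_star r) = ?h * (r + r)"
    by (simp add: algebra_simps)
  also have "\<dots> = rel_const (1 / 2 + 1 / 2) * r"
    by (simp only: rel_const_add distrib_left distrib_right)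
  finally show "r = ?h * (r + rel_star r) + ?h * (r - rel_star r)"
    by (simp add: rel_const_one)
qed

text \<open>The bridge from the T-ideal to computation: the values of all letters are lifted, the
  lifts extend to an endomorphism, and the ideal is closed under it. From here on the basis
  polynomials are rules for arbitrary elements of the quotient of the right degree and symmetry, not
  just for letters.\<close>

lemma rel_extension_basis:
  assumes R: "\<And>x. R x \<in> rel_component (indet_degree x) (indet_symmetry x)"
    and f: "f \<in> basis_polynomials"
  shows "rel.extension R f = 0"
proof -
  have "\<exists>p. p \<in> free_component (indet_degree x) \<and>
      free_star p = const (symmetry_sign (indet_symmetry x)) * p \<and> proj p = R x" for x
    using rel_component_lift[OF R] by metis
  then obtain s where s: "\<And>x. s x \<in> free_component (indet_degree x)"
      "\<And>x. free_star (s x) = const (symmetry_sign (indet_symmetry x)) * s x"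
      "\<And>x. proj (s x) = R x"
    by metis
  have "graded_star_endomorphism (free_alg.extension s)"
    by (rule graded_star_endomorphism_extension) (simp add: admissible_substitution_def s)
  then have "free_alg.extension s f \<in> basis_ideal"
    using f generated_T_ideal_superset basis_ideal_closed(6) by blast
  then have "proj (free_alg.extension s f) = 0"
    by (simp add: proj_eq_0_iff)
  moreover have "proj (free_alg.extension s f) =
      rel.extension (\<lambda>x. proj (free_alg.extension s (var x))) f"
    by (rule rel.extension_unique)
      (simp_all add: free_alg.extension_add free_alg.extension_mult free_alg.extension_const
        proj_add proj_mult rel_const_def)
  ultimately show ?thesis
    by (simp add: free_alg.extension_var s(3))
qed

section \<open>The basis polynomials as laws of the quotient\<close>

definition letter :: "bit \<Rightarrow> symmetry \<Rightarrow> nat \<Rightarrow> indet" where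
  "letter g s n = (if g = 0 then Y s n else Z s n)"

lemma letter_simps [simp]: "letter 0 s n = Y s n" "letter 1 s n = Z s n"
  by (simp_all add: letter_def)

lemma letter_eq_iff: "letter g s n = letter h t m \<longleftrightarrow> g = h \<and> s = t \<and> n = m"
  using bit_cases[of g] bit_cases[of h] by auto

lemma rel_assignment:
  assumes "a \<in> rel_component g1 s1" "b \<in> rel_component g2 s2"
    "c \<in> rel_component g3 s3" "d \<in> rel_component g4 s4"
  obtains R where "\<And>x. R x \<in> rel_component (indet_degree x) (indet_symmetry x)"
    "R (letter g1 s1 1) = a" "R (letter g2 s2 2) = b" "R (letter g3 s3 3) = c"
    "R (letter g4 s4 4) = d"
proof -
  let ?R = "\<lambda>x. if x = letter g1 s1 1 then a else if x = letter g2 s2 2 then b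
    else if x = letter g3 s3 3 then c else if x = letter g4 s4 4 then d else 0"
  have ds: "indet_degree (letter g s n) = g" "indet_symmetry (letter g s n) = s" for g s n
    using bit_cases[of g] by auto
  have "?R x \<in> rel_component (indet_degree x) (indet_symmetry x)" for x
    using assms by (auto simp: ds zero_in_rel_component)
  moreover have "?R (letter g1 s1 1) = a" "?R (letter g2 s2 2) = b" "?R (letter g3 s3 3) = c"
    "?R (letter g4 s4 4) = d"
    by (simp_all add: letter_eq_iff)
  ultimately show ?thesis
    by (rule that)
qed

lemma rel_extension_uminus: "rel.extension s (- p) = - rel.extension s p"
  using rel.extension_add[of s p "- p"] by (simp add: rel.extension_zero eq_neg_iff_add_eq_0 add.commute)

lemma rel_extension_diff: "rel.extension s (p - q) = rel.extension s p - rel.extension s q"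
  using rel.extension_add[of s p "- q"] by (simp add: rel_extension_uminus)

lemmas rel_extension_simps = rel.extension_add rel_extension_diff rel.extension_mult
  rel.extension_var commutator_def

lemma letters_in_sets:
  "letter 0 Sym n \<in> Y_plus" "letter 0 Skew n \<in> Y_minus" "letter 1 Sym n \<in> Z_plus"
  "letter 1 Skew n \<in> Z_minus" "letter 1 s n \<in> Z_all"
  by (cases s; simp add: Y_plus_def Y_minus_def Z_plus_def Z_minus_def Z_all_def)+

lemma rel_identity1:
  assumes "(g, s) \<in> {(0, Skew), (1, Sym), (1, Skew)}"
    and "a \<in> rel_component g s" "c \<in> rel_component g s" "b \<in> rel_component h t"
  shows "a * b * c = c * b * a"
proof -
  obtain R where R: "\<And>x. R x \<in> rel_component (indet_degree x) (indet_symmetry x)"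
    "R (letter g s 1) = a" "R (letter h t 2) = b" "R (letter g s 3) = c"
    using assms rel_assignment[of a g s b h t c g s 0 g s] zero_in_rel_component by metis
  let ?x = "letter g s 1" and ?y = "letter h t 2" and ?z = "letter g s 3"
  have "var ?x * var ?y * var ?z - var ?z * var ?y * var ?x \<in>
      (basis_polynomials :: 'a free_algebra set)"
    using assms(1) letters_in_sets
    by (intro basis_polynomials.id1[where A =
          "if g = 0 then Y_minus else if s = Sym then Z_plus else Z_minus"])
      (auto simp: letter_eq_iff simp del: letter_simps One_nat_def)
  from rel_extension_basis[OF R(1) this] show ?thesis
    by (simp add: rel_extension_simps R del: letter_simps One_nat_def)
qed

lemma rel_identity2_homogeneous:
  assumes "a \<in> rel_component 1 s" "b \<in> rel_component 1 t" "c \<in> rel_component 1 u"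
  shows "a * b * c = 0"
proof -
  obtain R where R: "\<And>x. R x \<in> rel_component (indet_degree x) (indet_symmetry x)"
    "R (letter 1 s 1) = a" "R (letter 1 t 2) = b" "R (letter 1 u 3) = c"
    using assms rel_assignment[of a 1 s b 1 t c 1 u 0 1 s] zero_in_rel_component by metis
  have "var (letter 1 s 1) * var (letter 1 t 2) * var (letter 1 u 3) \<in>
      (basis_polynomials :: 'a free_algebra set)"
    by (rule basis_polynomials.id2) (simp_all only: letters_in_sets, simp)
  from rel_extension_basis[OF R(1) this] show ?thesis
    by (simp add: rel_extension_simps R del: letter_simps One_nat_def)
qed

lemma rel_identity3:
  assumes "a \<in> rel_component g s" "b \<in> rel_component g s"
  shows "a * b = b * a"
proof -
  obtain R where R: "\<And>x. R x \<in> rel_component (indet_degree x) (indet_symmetry x)"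
    "R (letter g s 1) = a" "R (letter g s 2) = b"
    using assms rel_assignment[of a g s b g s 0 g s 0 g s] zero_in_rel_component by metis
  have "commutator (var (letter g s 1)) (var (letter g s 2)) \<in>
      (basis_polynomials :: 'a free_algebra set)"
    using letters_in_sets bit_cases[of g]
    by (intro basis_polynomials.id3[where A =
          "if g = 0 then if s = Sym then Y_plus else Y_minus
           else if s = Sym then Z_plus else Z_minus"])
      (cases s; auto simp: letter_eq_iff simp del: letter_simps)+
  from rel_extension_basis[OF R(1) this] show ?thesis
    by (simp add: rel_extension_simps R del: letter_simps One_nat_def)
qed

lemma rel_identity4_homogeneous:
  assumes "a \<in> Yp" "b \<in> Ym" "c \<in> rel_component g s" "d \<in> rel_component h t"
  shows "(a * b - b * a) * (c * d - d * c) = 0"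
proof -
  obtain R where R: "\<And>x. R x \<in> rel_component (indet_degree x) (indet_symmetry x)"
    "R (letter 0 Sym 1) = a" "R (letter 0 Skew 2) = b" "R (letter g s 3) = c" "R (letter h t 4) = d"
    using assms rel_assignment[of a 0 Sym b 0 Skew c g s d h t] by metis
  have "commutator (var (letter 0 Sym 1)) (var (letter 0 Skew 2)) *
      commutator (var (letter g s 3)) (var (letter h t 4)) \<in>
      (basis_polynomials :: 'a free_algebra set)"
    by (rule basis_polynomials.id4)
      (simp_all only: letters_in_sets, simp add: letter_eq_iff del: letter_simps One_nat_def)
  from rel_extension_basis[OF R(1) this] show ?thesis
    by (simp add: rel_extension_simps R del: letter_simps One_nat_def)
qed

lemma rel_identity5_homogeneous:
  assumes "a \<in> Yp" "b \<in> rel_component 1 s" "c \<in> rel_component 1 t"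
  shows "a * (b * c) = b * c * a"
proof -
  obtain R where R: "\<And>x. R x \<in> rel_component (indet_degree x) (indet_symmetry x)"
    "R (letter 0 Sym 1) = a" "R (letter 1 s 2) = b" "R (letter 1 t 3) = c"
    using assms rel_assignment[of a 0 Sym b 1 s c 1 t 0 1 t] zero_in_rel_component by metis
  have "commutator (var (letter 0 Sym 1)) (var (letter 1 s 2) * var (letter 1 t 3)) \<in>
      (basis_polynomials :: 'a free_algebra set)"
    by (rule basis_polynomials.id5)
      (simp_all only: letters_in_sets, simp add: letter_eq_iff del: letter_simps One_nat_def)
  from rel_extension_basis[OF R(1) this] show ?thesis
    by (simp add: rel_extension_simps R del: letter_simps One_nat_def)
qed

lemma rel_identity6_homogeneous:
  assumes "a \<in> Yp" "b \<in> Ym" "c \<in> rel_component 1 s"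
  shows "(a * b - b * a) * c = 0" "c * (a * b - b * a) = 0"
proof -
  obtain R where R: "\<And>x. R x \<in> rel_component (indet_degree x) (indet_symmetry x)"
    "R (letter 0 Sym 1) = a" "R (letter 0 Skew 2) = b" "R (letter 1 s 3) = c"
    using assms rel_assignment[of a 0 Sym b 0 Skew c 1 s 0 1 s] zero_in_rel_component by metis
  have "commutator (var (letter 0 Sym 1)) (var (letter 0 Skew 2)) * var (letter 1 s 3) \<in>
      (basis_polynomials :: 'a free_algebra set)"
    by (rule basis_polynomials.id6_left) (simp_all only: letters_in_sets)
  from rel_extension_basis[OF R(1) this] show "(a * b - b * a) * c = 0"
    by (simp add: rel_extension_simps R del: letter_simps One_nat_def)
  have "var (letter 1 s 3) * commutator (var (letter 0 Sym 1)) (var (letter 0 Skew 2)) \<in>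
      (basis_polynomials :: 'a free_algebra set)"
    by (rule basis_polynomials.id6_right) (simp_all only: letters_in_sets)
  from rel_extension_basis[OF R(1) this] show "c * (a * b - b * a) = 0"
    by (simp add: rel_extension_simps R del: letter_simps One_nat_def)
qed

lemma rel_identity7:
  assumes "a \<in> Yp" "b \<in> Ym" "c \<in> Ym"
  shows "(a * b - b * a) * c = - (c * (a * b - b * a))"
proof -
  obtain R where R: "\<And>x. R x \<in> rel_component (indet_degree x) (indet_symmetry x)"
    "R (letter 0 Sym 1) = a" "R (letter 0 Skew 2) = b" "R (letter 0 Skew 3) = c"
    using assms rel_assignment[of a 0 Sym b 0 Skew c 0 Skew 0 1 Sym] zero_in_rel_component by metis
  have "commutator (var (letter 0 Sym 1)) (var (letter 0 Skew 2)) * var (letter 0 Skew 3) +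
      var (letter 0 Skew 3) * commutator (var (letter 0 Sym 1)) (var (letter 0 Skew 2)) \<in>
      (basis_polynomials :: 'a free_algebra set)"
    by (rule basis_polynomials.id7)
      (simp_all only: letters_in_sets, simp add: letter_eq_iff del: letter_simps One_nat_def)
  from rel_extension_basis[OF R(1) this] show ?thesis
    by (simp add: rel_extension_simps R eq_neg_iff_add_eq_0 del: letter_simps One_nat_def)
qed

lemma rel_identity8_homogeneous:
  assumes "a \<in> Ym" "b \<in> rel_component 1 s" "c \<in> Ym"
  shows "a * b * c = 0"
proof -
  obtain R where R: "\<And>x. R x \<in> rel_component (indet_degree x) (indet_symmetry x)"
    "R (letter 0 Skew 1) = a" "R (letter 1 s 2) = b" "R (letter 0 Skew 3) = c"
    using assms rel_assignment[of a 0 Skew b 1 s c 0 Skew 0 1 Sym] zero_in_rel_component by metis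
  have "var (letter 0 Skew 1) * var (letter 1 s 2) * var (letter 0 Skew 3) \<in>
      (basis_polynomials :: 'a free_algebra set)"
    by (rule basis_polynomials.id8)
      (simp_all only: letters_in_sets, simp add: letter_eq_iff del: letter_simps One_nat_def)
  from rel_extension_basis[OF R(1) this] show ?thesis
    by (simp add: rel_extension_simps R del: letter_simps One_nat_def)
qed

lemma rel_identity9_homogeneous:
  assumes "a \<in> rel_component 1 s" "b \<in> Ym" "c \<in> rel_component 1 t"
  shows "a * b * c = 0"
proof -
  obtain R where R: "\<And>x. R x \<in> rel_component (indet_degree x) (indet_symmetry x)"
    "R (letter 1 s 1) = a" "R (letter 0 Skew 2) = b" "R (letter 1 t 3) = c"
    using assms rel_assignment[of a 1 s b 0 Skew c 1 t 0 1 Sym] zero_in_rel_component by metis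
  have "var (letter 1 s 1) * var (letter 0 Skew 2) * var (letter 1 t 3) \<in>
      (basis_polynomials :: 'a free_algebra set)"
    by (rule basis_polynomials.id9)
      (simp_all only: letters_in_sets, simp add: letter_eq_iff del: letter_simps One_nat_def)
  from rel_extension_basis[OF R(1) this] show ?thesis
    by (simp add: rel_extension_simps R del: letter_simps One_nat_def)
qed

lemma rel_identity10:
  assumes "a \<in> Zp" "b \<in> Zm"
  shows "a * b = - (b * a)"
proof -
  obtain R where R: "\<And>x. R x \<in> rel_component (indet_degree x) (indet_symmetry x)"
    "R (letter 1 Sym 1) = a" "R (letter 1 Skew 2) = b"
    using assms rel_assignment[of a 1 Sym b 1 Skew 0 1 Sym 0 1 Sym] zero_in_rel_component by metis
  have "var (letter 1 Sym 1) * var (letter 1 Skew 2) + var (letter 1 Skew 2) * var (letter 1 Sym 1) \<in>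
      (basis_polynomials :: 'a free_algebra set)"
    by (rule basis_polynomials.id10) (simp_all only: letters_in_sets)
  from rel_extension_basis[OF R(1) this] show ?thesis
    by (simp add: rel_extension_simps R eq_neg_iff_add_eq_0 del: letter_simps One_nat_def)
qed

lemma rel_identity11_homogeneous:
  assumes "a \<in> Ym" "b \<in> rel_component 1 s" "c \<in> rel_component 1 t"
  shows "b * c * a = - (a * b * c)"
proof -
  obtain R where R: "\<And>x. R x \<in> rel_component (indet_degree x) (indet_symmetry x)"
    "R (letter 0 Skew 1) = a" "R (letter 1 s 2) = b" "R (letter 1 t 3) = c"
    using assms rel_assignment[of a 0 Skew b 1 s c 1 t 0 1 t] zero_in_rel_component by metis
  have "var (letter 1 s 2) * var (letter 1 t 3) * var (letter 0 Skew 1) +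
      var (letter 0 Skew 1) * var (letter 1 s 2) * var (letter 1 t 3) \<in>
      (basis_polynomials :: 'a free_algebra set)"
    by (rule basis_polynomials.id11)
      (simp_all only: letters_in_sets, simp add: letter_eq_iff del: letter_simps One_nat_def)
  from rel_extension_basis[OF R(1) this] show ?thesis
    by (simp add: rel_extension_simps R eq_neg_iff_add_eq_0 del: letter_simps One_nat_def)
qed

section \<open>Reduction of words\<close>

text \<open>The law is additive in each argument and an element of degree one is a symmetric plus a
  skew one, so the version for elements of definite symmetry extends. The same argument gives the
  versions below, whose arguments of degree one are then blocks of letters of no definite
  symmetry.\<close>

lemma rel_identity2:
  assumes "a \<in> rel_degree 1" "b \<in> rel_degree 1" "c \<in> rel_degree 1"
  shows "a * b * c = 0"
  using assms
  by (auto elim!: rel_degree_split simp: distrib_left distrib_right rel_identity2_homogeneous)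

lemma rel_identity5:
  assumes "a \<in> Yp" "b \<in> rel_degree 1" "c \<in> rel_degree 1"
  shows "a * (b * c) = b * c * a"
  using assms(2,3)
  by (auto elim!: rel_degree_split
      simp: distrib_left distrib_right rel_identity5_homogeneous[OF assms(1)])

lemma rel_identity6:
  assumes "a \<in> Yp" "b \<in> Ym" "c \<in> rel_degree 1"
  shows "a * b * c = b * a * c" "c * a * b = c * b * a"
proof -
  obtain c1 c2 where c: "c1 \<in> Zp" "c2 \<in> Zm" "c = c1 + c2"
    using assms(3) by (rule rel_degree_split)
  have "(a * b - b * a) * c = 0" "c * (a * b - b * a) = 0"
    using rel_identity6_homogeneous[OF assms(1,2) c(1)] rel_identity6_homogeneous[OF assms(1,2) c(2)]
    by (simp_all only: c(3) distrib_left distrib_right add_0)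
  then show "a * b * c = b * a * c" "c * a * b = c * b * a"
    by (simp_all add: algebra_simps)
qed

lemma rel_identity8:
  assumes "a \<in> Ym" "b \<in> rel_degree 1" "c \<in> Ym"
  shows "a * b * c = 0"
  using assms(2)
  by (auto elim!: rel_degree_split
      simp: distrib_left distrib_right rel_identity8_homogeneous[OF assms(1) _ assms(3)])

lemma rel_identity9:
  assumes "a \<in> rel_degree 1" "b \<in> Ym" "c \<in> rel_degree 1"
  shows "a * b * c = 0"
  using assms(1,3)
  by (auto elim!: rel_degree_split
      simp: distrib_left distrib_right rel_identity9_homogeneous[OF _ assms(2)])

lemma rel_identity11:
  assumes "a \<in> Ym" "b \<in> rel_degree 1" "c \<in> rel_degree 1"
  shows "b * c * a = - (a * b * c)"
  using assms(2,3)
  by (auto elim!: rel_degree_split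
      simp: distrib_left distrib_right rel_identity11_homogeneous[OF assms(1)])

text \<open>The element \<open>a * v + v * a\<close> is again symmetric of degree one, so it
  anticommutes with \<open>b\<close>. Of the four resulting terms, the two with \<open>v\<close>
  outside cancel, because \<open>a * b = - (b * a)\<close> and \<open>v\<close> commutes with
  \<open>b * a\<close>.\<close>

lemma rel_identity10_middle:
  assumes a: "a \<in> Zp" and b: "b \<in> Zm" and v: "v \<in> Yp"
  shows "a * v * b = - (b * v * a)"
proof -
  have deg: "a \<in> rel_degree 1" "b \<in> rel_degree 1" "v \<in> rel_degree 0"
    using assms by (simp_all add: rel_component_def)
  have "a * v \<in> rel_degree 1" "v * a \<in> rel_degree 1"
    using rel_degree_mult[OF deg(1,3)] rel_degree_mult[OF deg(3,1)] by (simp_all only: add_0 add_0_right)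
  then have "a * v + v * a \<in> Zp"
    using a v by (simp add: rel_component_def rel_degree_add rel_star_add rel_star_mult
        rel_const_one add.commute)
  then have "(a * v + v * a) * b = - (b * (a * v + v * a))"
    using b by (rule rel_identity10)
  then have "a * v * b + v * (a * b) = - (b * a * v) - b * v * a"
    by (simp add: algebra_simps)
  also have "v * (a * b) = - (v * (b * a))"
    by (simp add: rel_identity10[OF a b])
  also have "v * (b * a) = b * a * v"
    by (rule rel_identity5[OF v deg(2,1)])
  finally show ?thesis
    by (simp add: eq_neg_iff_add_eq_0 algebra_simps)
qed

abbreviation gen :: "indet \<Rightarrow> 'a::field_char_0 rel_free" where
  "gen x \<equiv> proj (var x)"

abbreviation val :: "indet list \<Rightarrow> 'a::field_char_0 rel_free" where
  "val \<equiv> rel.word_value gen"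

lemma gen_in_component: "gen x \<in> rel_component (indet_degree x) (indet_symmetry x)"
  unfolding rel_component_def rel_degree_def
  by (simp add: rel_star_proj free_star_var proj_mult rel_const_def free_component_var)

lemma gen_Y: "gen (Y s n) \<in> rel_component 0 s"
  by (rule gen_in_component[of "Y s n", simplified])

lemma gen_Z: "gen (Z s n) \<in> rel_component 1 s"
  by (rule gen_in_component[of "Z s n", simplified])

lemma gen_Y_degree: "\<not> is_Z x \<Longrightarrow> gen x \<in> rel_degree 0"
  using gen_Y by (cases x) (auto simp: rel_component_def)

lemma gen_Z_degree: "is_Z x \<Longrightarrow> gen x \<in> rel_degree 1"
  using gen_Z by (cases x) (auto simp: rel_component_def)

lemma rel_degree_mult_0:
  "a \<in> rel_degree 0 \<Longrightarrow> b \<in> rel_degree g \<Longrightarrow> a * b \<in> rel_degree g"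
  "a \<in> rel_degree 0 \<Longrightarrow> b \<in> rel_degree g \<Longrightarrow> b * a \<in> rel_degree g"
  using rel_degree_mult[of a 0 b g] rel_degree_mult[of b g a 0] by (simp_all only: add_0 add_0_right)

lemma val_Y_word_degree: "Y_word w \<Longrightarrow> val w \<in> rel_degree 0"
proof (induction w)
  case Nil
  then show ?case
    using rel_degree_const[of 1] by (simp add: rel_const_one)
qed (simp add: rel_degree_mult_0 gen_Y_degree)

text \<open>Commutation is required only on an invariant set \<open>T\<close>. This matters because
  letters of degree zero do not commute in the quotient, but their multiplications do when they act
  on elements of degree one.\<close>

lemma foldr_mset_cong_on:
  assumes closed: "\<And>x t. x \<in> S \<Longrightarrow> t \<in> T \<Longrightarrow> act x t \<in> T"
    and comm: "\<And>x y t. x \<in> S \<Longrightarrow> y \<in> S \<Longrightarrow> t \<in> T \<Longrightarrow> act x (act y t) = act y (act x t)"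
    and "set xs \<subseteq> S" "mset xs = mset ys" "t \<in> T"
  shows "foldr act xs t = foldr act ys t"
  using assms(3,4)
proof (induction xs arbitrary: ys)
  case (Cons x xs)
  have "x \<in> set ys"
    using Cons.prems(2) by (metis list.set_intros(1) set_mset_mset)
  then obtain p q where ys: "ys = p @ x # q"
    by (auto dest: split_list)
  have pq: "mset xs = mset (p @ q)"
    using Cons.prems(2) by (simp add: ys)
  have S: "set (p @ q) \<subseteq> S" "x \<in> S"
    using Cons.prems(1) mset_eq_setD[OF pq] by auto
  have T: "foldr act l t \<in> T" if "set l \<subseteq> S" for l
    using that by (induction l) (auto intro: closed assms(5))
  have "foldr act (p @ x # q) t = act x (foldr act (p @ q) t)"
    using S
  proof (induction p)
    case (Cons z p)
    then have "foldr act (p @ x # q) t = act x (foldr act (p @ q) t)" by simp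
    with Cons.prems show ?case
      using comm[of z x "foldr act (p @ q) t"] T[of "p @ q"] by simp
  qed simp
  moreover have "foldr act xs t = foldr act (p @ q) t"
    using Cons.prems(1) pq by (intro Cons.IH) auto
  ultimately show ?case
    by (simp add: ys)
qed simp

lemma val_mult_foldr: "val w * r = foldr (\<lambda>x r. gen x * r) w r"
  by (induction w) (simp_all add: mult.assoc)

lemma mult_val_foldr: "r * val w = foldr (\<lambda>x r. r * gen x) (rev w) r"
proof (induction w arbitrary: r)
  case (Cons x w)
  show ?case
    using Cons.IH[of "r * gen x"] by (simp add: mult.assoc)
qed simp

lemma val_commuting_mset_cong:
  assumes "\<And>x y. x \<in> S \<Longrightarrow> y \<in> S \<Longrightarrow> gen x * gen y = (gen y * gen x :: 'a::field_char_0 rel_free)"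
    and "set u \<subseteq> S" "mset u = mset v"
  shows "val u = (val v :: 'a rel_free)"
proof -
  have "foldr (\<lambda>x r. gen x * r) u (1 :: 'a rel_free) = foldr (\<lambda>x r. gen x * r) v 1"
    by (rule foldr_mset_cong_on[where T = UNIV and S = S, OF _ _ assms(2,3)])
      (simp_all add: assms(1) flip: mult.assoc)
  then show ?thesis
    by (simp flip: val_mult_foldr)
qed

lemma val_Y_plus_mset_cong: "set u \<subseteq> Y_plus \<Longrightarrow> mset u = mset v \<Longrightarrow> val u = val v"
  by (rule val_commuting_mset_cong[where S = Y_plus])
    (auto simp: Y_plus_def intro: rel_identity3 gen_Y)

lemma val_Y_minus_mset_cong: "set u \<subseteq> Y_minus \<Longrightarrow> mset u = mset v \<Longrightarrow> val u = val v"
  by (rule val_commuting_mset_cong[where S = Y_minus])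
    (auto simp: Y_minus_def intro: rel_identity3 gen_Y)

text \<open>Letters of equal symmetry commute anyway; the commutator of a symmetric and a skew one
  is annihilated by degree one from both sides.\<close>

lemma gen_Y_commute_degree_1:
  assumes "\<not> is_Z x" "\<not> is_Z y" "d \<in> rel_degree 1"
  shows "gen x * gen y * d = gen y * gen x * d" "d * gen x * gen y = d * gen y * gen x"
proof -
  obtain s n t m where x: "x = Y s n" and y: "y = Y t m"
    using assms(1,2) by (cases x; cases y) auto
  have "gen x * gen y * d = gen y * gen x * d \<and> d * gen x * gen y = d * gen y * gen x"
  proof (cases "s = t")
    case True
    then have "gen x * gen y = gen y * gen x"
      by (auto simp: x y intro: rel_identity3 gen_Y)
    then show ?thesis
      by (metis mult.assoc)
  next
    case False
    then consider "s = Sym" "t = Skew" | "s = Skew" "t = Sym"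
      by (cases s; cases t) auto
    then show ?thesis
      using rel_identity6[OF gen_Y gen_Y assms(3)] unfolding x y by cases metis+
  qed
  then show "gen x * gen y * d = gen y * gen x * d" "d * gen x * gen y = d * gen y * gen x"
    by blast+
qed

text \<open>A block of degree-zero letters beside an element of degree one may be sorted at
  will.\<close>

lemma val_mult_degree_1_mset_cong:
  assumes "Y_word u" "mset u = mset v" "d \<in> rel_degree 1"
  shows "val u * d = val v * d"
  unfolding val_mult_foldr
  by (rule foldr_mset_cong_on[where T = "rel_degree 1" and S = "{x. \<not> is_Z x}"])
    (use assms in \<open>auto simp: Y_word_def rel_degree_mult_0 gen_Y_degree gen_Y_commute_degree_1
      simp flip: mult.assoc\<close>)

lemma degree_1_mult_val_mset_cong:
  assumes "Y_word u" "mset u = mset v" "d \<in> rel_degree 1"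
  shows "d * val u = d * val v"
  unfolding mult_val_foldr
  by (rule foldr_mset_cong_on[where T = "rel_degree 1" and S = "{x. \<not> is_Z x}"])
    (use assms in \<open>auto simp: Y_word_def rel_degree_mult_0 gen_Y_degree gen_Y_commute_degree_1\<close>)

lemma Y_word_iff: "Y_word w \<longleftrightarrow> set w \<subseteq> Y_plus \<union> Y_minus"
proof -
  have "\<not> is_Z x \<longleftrightarrow> x \<in> Y_plus \<union> Y_minus" for x
  proof (cases x)
    case (Y s n)
    then show ?thesis
      by (cases s) (auto simp: Y_plus_def Y_minus_def)
  qed (auto simp: Y_plus_def Y_minus_def)
  then show ?thesis
    by (auto simp: Y_word_def)
qed

lemma Y_plus_imp_Y_word: "set w \<subseteq> Y_plus \<Longrightarrow> Y_word w"
  by (auto simp: Y_word_iff)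

lemma not_Y_plus_split:
  assumes "Y_word w" "\<not> set w \<subseteq> Y_plus"
  obtains u n v where "w = u @ Y Skew n # v" "Y_word u" "Y_word v"
proof -
  obtain x where x: "x \<in> set w" "x \<in> Y_minus"
    using assms by (auto simp: Y_word_iff)
  from x(1) obtain u v where "w = u @ x # v"
    by (auto dest: split_list)
  then show ?thesis
    using that x(2) assms(1) by (auto simp: Y_minus_def)
qed

lemma rel_star_one: "rel_star 1 = 1"
  by (metis proj_one rel_star_proj free_star_one)

text \<open>The involution reverses the word, and symmetric letters commute in the quotient. Hence a
  whole block of symmetric letters can stand for a single one in the laws.\<close>

lemma val_Y_plus_in_Yp:
  assumes "set v \<subseteq> Y_plus"
  shows "(val v :: 'a::field_char_0 rel_free) \<in> Yp"
proof -
  have star: "rel_star (val w) = (val (rev w) :: 'a rel_free)" if "set w \<subseteq> Y_plus" for w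
    using that
  proof (induction w)
    case Nil
    then show ?case
      by (simp add: rel_star_one)
  next
    case (Cons x w)
    have "rel_star (gen x) = (gen x :: 'a rel_free)"
      using Cons.prems gen_Y[of Sym] by (auto simp: Y_plus_def rel_component_def rel_const_one)
    then show ?case
      using Cons by (simp add: rel_star_mult rel.word_value_append)
  qed
  have "val (rev v) = (val v :: 'a rel_free)"
    using assms by (intro val_Y_plus_mset_cong) simp_all
  then show ?thesis
    using assms val_Y_word_degree[OF Y_plus_imp_Y_word]
    by (simp add: rel_component_def star rel_const_one)
qed

section \<open>Signs, monomials and the shape of words\<close>

lemma row1_Y_word_append: "Y_word u \<Longrightarrow> row1 (u @ w) = row1 w"
  by (induction u rule: row1.induct) simp_all

lemma row3_Y_word_append: "Y_word u \<Longrightarrow> row3 (u @ w) = row3 u * row3 w"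
  by (induction u rule: row3.induct) simp_all

text \<open>A skew letter of degree zero has middle diagonal entry zero, so it blocks a path that
  stays in row 2.\<close>

lemma row2_Y_word_append:
  "Y_word u \<Longrightarrow> row2 (u @ w) = (if set u \<subseteq> Y_plus then row2 w else 0)"
  by (induction u rule: row2.induct) (auto simp: Y_plus_def)

lemma row2_Y_word: "Y_word u \<Longrightarrow> row2 u = (if set u \<subseteq> Y_plus then 1 else 0)"
  using row2_Y_word_append[of u "[]"] by simp

lemma row1_Y_word: "Y_word u \<Longrightarrow> row1 u = 1"
  using row1_Y_word_append[of u "[]"] by simp

lemma monomial_Y_word: "Y_word u \<Longrightarrow> monomial p u = image_mset (Pair p) (mset u)"
  by (induction u) simp_all

lemma row3_Y_word_square: "Y_word u \<Longrightarrow> row3 u * row3 u = 1"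
  by (induction u rule: row3.induct) simp_all

text \<open>On words in \<open>Y\<close> the sign is -1 to the number of skew letters, hence
  independent of the order.\<close>

lemma row3_Y_word_eq: "Y_word u \<Longrightarrow> row3 u = prod_mset (image_mset (\<lambda>x. row3 [x]) (mset u))"
  by (induction u rule: row3.induct) simp_all

lemma row3_mset_cong: "Y_word u \<Longrightarrow> mset u = mset v \<Longrightarrow> row3 u = row3 v"
  by (metis row3_Y_word_eq Y_word_def mset_eq_setD)

lemma monomial_Y_word_append:
  "Y_word u \<Longrightarrow> monomial p (u @ w) = image_mset (Pair p) (mset u) + monomial p w"
  by (induction u) simp_all

lemma first_Z:
  assumes "\<not> Y_word w"
  obtains u z v where "w = u @ z # v" "Y_word u" "is_Z z"
proof -
  have "\<exists>x\<in>set w. is_Z x"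
    using assms by (auto simp: Y_word_def)
  then obtain u z v where "w = u @ z # v" "is_Z z" "\<forall>x\<in>set u. \<not> is_Z x"
    using split_list_first_prop[of w is_Z] by blast
  then show ?thesis
    using that by (auto simp: Y_word_def)
qed

text \<open>Cases by the number of letters of degree one. In the last case \<open>s\<close> is
  unrestricted, so it covers three or more.\<close>

lemma word_cases:
  obtains (zero) "Y_word w"
  | (one) u z v where "w = u @ z # v" "is_Z z" "Y_word u" "Y_word v"
  | (two) u z v z' t where "w = u @ z # v @ z' # t" "is_Z z" "is_Z z'" "Y_word u" "Y_word v" "Y_word t"
  | (three) u z v z' t z'' s where "w = u @ z # v @ z' # t @ z'' # s" "is_Z z" "is_Z z'" "is_Z z''"
      "Y_word u" "Y_word v" "Y_word t"
proof (cases "Y_word w")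
  case False
  then obtain u z v where w: "w = u @ z # v" "Y_word u" "is_Z z"
    by (rule first_Z)
  show ?thesis
  proof (cases "Y_word v")
    case False
    then obtain v1 z' t where v: "v = v1 @ z' # t" "Y_word v1" "is_Z z'"
      by (rule first_Z)
    show ?thesis
    proof (cases "Y_word t")
      case False
      then obtain t1 z'' s where "t = t1 @ z'' # s" "Y_word t1" "is_Z z''"
        by (rule first_Z)
      then show ?thesis
        using three w v by simp
    qed (use two w v in simp)
  qed (use one w in simp)
qed (rule zero)

text \<open>Decodes a monomial: for a start in an outer row, flag \<open>False\<close> collects the
  degree-zero letters that follow an odd number of letters of degree one, and flag
  \<open>True\<close> the others. For a start in the middle row the roles are exchanged.\<close>

definition Y_part :: "bool \<Rightarrow> (bool \<times> indet) multiset \<Rightarrow> indet multiset" where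
  "Y_part b m = image_mset snd (filter_mset (\<lambda>(p, x). p = b \<and> \<not> is_Z x) m)"

definition Z_part :: "(bool \<times> indet) multiset \<Rightarrow> indet multiset" where
  "Z_part m = image_mset snd (filter_mset (\<lambda>(p, x). is_Z x) m)"

lemma part_simps [simp]:
  "Y_part b {#} = {#}" "Z_part {#} = {#}"
  "Y_part b (m + n) = Y_part b m + Y_part b n" "Z_part (m + n) = Z_part m + Z_part n"
  "is_Z z \<Longrightarrow> Y_part b (add_mset (p, z) m) = Y_part b m"
  "is_Z z \<Longrightarrow> Z_part (add_mset (p, z) m) = add_mset z (Z_part m)"
  by (simp_all add: Y_part_def Z_part_def)

lemma part_Y_word [simp]:
  "Y_word u \<Longrightarrow> Y_part b (image_mset (Pair b) (mset u)) = mset u"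
  "b \<noteq> p \<Longrightarrow> Y_part b (image_mset (Pair p) (mset u)) = {#}"
  "Y_word u \<Longrightarrow> Z_part (image_mset (Pair p) (mset u)) = {#}"
  by (induction u) (simp_all add: Y_part_def Z_part_def)

lemma mult_of_int_left_commute: "y * (of_int n * z) = of_int n * (y * z)"
  for y z :: "'b::ring_1"
  by (simp flip: mult.assoc mult_of_int_commute)

text \<open>A product of two elements of degree one commutes with symmetric letters and anticommutes
  with skew letters of degree zero; \<open>row3\<close> counts the sign changes.\<close>

lemma val_conjugate:
  assumes "b \<in> rel_degree 1" "c \<in> rel_degree 1" "Y_word t"
  shows "b * c * val t = of_int (row3 t) * val t * (b * c)"
  using assms(3)
proof (induction t)
  case (Cons x t)
  obtain s n where x: "x = Y s n"
    using Cons.prems by (cases x) auto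
  have "b * c * gen x = of_int (row3 [x]) * gen x * (b * c)"
    using rel_identity5[OF gen_Y assms(1,2), of n] rel_identity11[OF gen_Y assms(1,2), of n]
    by (cases s) (simp_all add: x mult.assoc)
  then have "b * c * val (x # t) = of_int (row3 [x]) * gen x * (b * c * val t)"
    by (simp add: mult.assoc[symmetric])
  also have "\<dots> = of_int (row3 [x]) * gen x * (of_int (row3 t) * val t * (b * c))"
    using Cons by simp
  also have "\<dots> = of_int (row3 [x]) * of_int (row3 t) * (gen x * val t) * (b * c)"
    by (simp only: mult.assoc mult_of_int_left_commute[of "gen x"])
  also have "of_int (row3 [x]) * of_int (row3 t) = (of_int (row3 (x # t)) :: 'a rel_free)"
    using Cons.prems row3_Y_word_append[of "[x]" t] by (simp flip: of_int_mult)
  finally show ?case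
    by simp
qed simp

text \<open>The ratio of the (2,3) entry to the (1,2) entry of the generic value.\<close>

definition Z_sign :: "indet \<Rightarrow> int" where
  "Z_sign z = row2 [z]"

lemma Z_sign_square: "is_Z z \<Longrightarrow> Z_sign z * Z_sign z = 1"
proof (cases z)
  case (Z s n)
  then show ?thesis
    by (cases s) (simp_all add: Z_sign_def)
qed simp

lemma row2_Z_Cons: "is_Z z \<Longrightarrow> row2 (z # w) = Z_sign z * row3 w"
proof (cases z)
  case (Z s n)
  then show ?thesis
    by (cases s) (simp_all add: Z_sign_def)
qed simp

lemma row1_Z_Cons: "is_Z z \<Longrightarrow> row1 (z # w) = row2 w"
  by (cases z) auto

lemma row3_Z_Cons: "is_Z z \<Longrightarrow> row3 (z # w) = 0"
  by (cases z) auto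

text \<open>The block \<open>val v\<close> acts as one symmetric element. For equal symmetries of
  \<open>z\<close> and \<open>z'\<close> the exchange is \<open>rel_identity1\<close>, for different
  ones \<open>rel_identity10_middle\<close>, and the signs on both sides absorb the minus.\<close>

lemma Z_swap:
  assumes "is_Z z" "is_Z z'" "set v \<subseteq> Y_plus"
  shows "of_int (Z_sign z') * (gen z * val v * gen z') =
    (of_int (Z_sign z) * (gen z' * val v * gen z) :: 'a::field_char_0 rel_free)"
proof -
  obtain s n where z: "z = Z s n" using assms(1) by (cases z) auto
  obtain s' n' where z': "z' = Z s' n'" using assms(2) by (cases z') auto
  have v: "(val v :: 'a rel_free) \<in> Yp"
    using assms(3) by (rule val_Y_plus_in_Yp)
  have same: "gen z * val v * gen z' = (gen z' * val v * gen z :: 'a rel_free)" if "s = s'"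
    using that v unfolding z z'
    by (intro rel_identity1[of 1 s' _ _ _ 0 Sym]) (auto simp: gen_Z intro: symmetry.exhaust)
  show ?thesis
    using same rel_identity10_middle[OF gen_Z gen_Z v, of n n']
      rel_identity10_middle[OF gen_Z gen_Z v, of n' n]
    by (cases s; cases s') (simp_all add: z z' Z_sign_def)
qed

text \<open>All degree-zero letters outside the two letters of degree one are gathered in front,
  where they can be sorted.\<close>

lemma val_two_Z:
  assumes "is_Z z" "is_Z z'" "Y_word v" "Y_word t"
  shows "val (u @ z # v @ z' # t) =
    (of_int (row3 t) * (val (u @ t) * (gen z * val v * gen z')) :: 'a::field_char_0 rel_free)"
proof -
  have "gen z * val v \<in> (rel_degree 1 :: 'a rel_free set)"
    "gen z' \<in> (rel_degree 1 :: 'a rel_free set)"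
    using assms by (simp_all add: rel_degree_mult_0 val_Y_word_degree gen_Z_degree)
  from val_conjugate[OF this assms(4)]
  have "val (u @ z # v @ z' # t) =
      (val u :: 'a rel_free) * (of_int (row3 t) * val t * (gen z * val v * gen z'))"
    by (simp add: rel.word_value_append mult.assoc[symmetric])
  also have "\<dots> = of_int (row3 t) * (val (u @ t) * (gen z * val v * gen z'))"
    by (simp only: rel.word_value_append mult.assoc mult_of_int_left_commute[of "val u"])
  finally show ?thesis .
qed

text \<open>A nonzero coefficient is a sign, hence its own inverse. This allows dividing by it in
  the quotient, where only a ring structure is at hand.\<close>

lemma row1_square:
  assumes "row1 w \<noteq> 0"
  shows "row1 w * row1 w = 1"
proof (cases w rule: word_cases)
  case zero
  then show ?thesis
    by (simp add: row1_Y_word)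
next
  case (one u z v)
  then show ?thesis
    using assms by (simp add: row1_Y_word_append row1_Z_Cons row2_Y_word split: if_splits)
next
  case (two u z v z' t)
  then have "row1 w = Z_sign z' * row3 t"
    using assms by (auto simp: row1_Y_word_append row1_Z_Cons row2_Y_word_append row2_Z_Cons split: if_splits)
  then have "row1 w * row1 w = (Z_sign z' * Z_sign z') * (row3 t * row3 t)"
    by (simp add: algebra_simps)
  then show ?thesis
    using two by (simp add: Z_sign_square row3_Y_word_square)
next
  case (three u z v z' t z'' s)
  then show ?thesis
    using assms
    by (simp add: row1_Y_word_append row1_Z_Cons row2_Y_word_append row2_Z_Cons
        row3_Y_word_append row3_Z_Cons split: if_splits)
qed

lemma row2_square:
  assumes "row2 w \<noteq> 0"
  shows "row2 w * row2 w = 1"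
proof (cases "Y_word w")
  case True
  then show ?thesis
    using assms by (simp add: row2_Y_word split: if_splits)
next
  case False
  then obtain u z v where w: "w = u @ z # v" "Y_word u" "is_Z z"
    by (rule first_Z)
  then have r: "row2 w = Z_sign z * row3 v"
    using assms by (simp add: row2_Y_word_append row2_Z_Cons split: if_splits)
  have "Y_word v"
  proof (rule ccontr)
    assume "\<not> Y_word v"
    then obtain p z' q where "v = p @ z' # q" "Y_word p" "is_Z z'"
      by (rule first_Z)
    then show False
      using r assms by (simp add: row3_Y_word_append row3_Z_Cons)
  qed
  then have "(Z_sign z * Z_sign z) * (row3 v * row3 v) = 1"
    using w by (simp add: Z_sign_square row3_Y_word_square)
  then show ?thesis
    by (simp add: r algebra_simps)
qed

text \<open>If row 1 is nonzero, only symmetric letters follow a single \<open>z\<close> or stand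
  between two such letters, and these can be permuted. The other degree-zero letters act on an
  element of degree one and can be sorted as well. So the multisets encoded in the monomial
  determine the value up to the sign.\<close>

lemma val_eq_of_monomial_True:
  assumes "row1 w \<noteq> 0" "row1 w' \<noteq> 0" "\<not> Y_word w" "monomial True w = monomial True w'"
  shows "of_int (row1 w) * val w = (of_int (row1 w') * val w' :: 'a::field_char_0 rel_free)"
proof (cases w rule: word_cases)
  case zero
  then show ?thesis using assms by simp
next
  case w: (one u z v)
  have v: "set v \<subseteq> Y_plus" and r: "row1 w = 1"
    using assms(1) w
    by (simp_all add: row2_Y_word row1_Y_word_append row1_Z_Cons split: if_splits)
  \<comment> \<open>The number of letters of degree one can be read off with \<open>Z_part\<close>,
    which leaves only the case of one such letter for \<open>w'\<close>; three or more are excluded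
    by the nonzero \<open>row1 w'\<close>.\<close>
  have m: "monomial True w' = image_mset (Pair True) (mset u) +
      add_mset (True, z) (image_mset (Pair False) (mset v))"
    using assms(4) w by (simp add: monomial_Y_word_append monomial_Y_word)
  show ?thesis
  proof (cases w' rule: word_cases)
    case zero
    then show ?thesis
      using arg_cong[OF m, of Z_part] w by (simp add: monomial_Y_word)
  next
    case w': (one u' z' v')
    have r': "row1 w' = 1"
      using assms(2) w'
      by (simp_all add: row2_Y_word row1_Y_word_append row1_Z_Cons split: if_splits)
    have m': "image_mset (Pair True) (mset u') +
      add_mset (True, z') (image_mset (Pair False) (mset v')) =
      image_mset (Pair True) (mset u) + add_mset (True, z) (image_mset (Pair False) (mset v))"
      using m w' by (simp add: monomial_Y_word_append monomial_Y_word)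
    have u: "mset u = mset u'"
      using arg_cong[OF m', of "Y_part True"] w w' by simp
    have vv: "mset v = mset v'"
      using arg_cong[OF m', of "Y_part False"] w w' by simp
    have z: "z = z'"
      using arg_cong[OF m', of "Z_part"] w w' by simp
    have "val u * gen z = (val u' * gen z :: 'a rel_free)"
      using val_mult_degree_1_mset_cong u w gen_Z_degree by blast
    moreover have "val v = (val v' :: 'a rel_free)"
      using v vv by (rule val_Y_plus_mset_cong)
    ultimately show ?thesis
      by (simp add: r[unfolded w(1) z] r'[unfolded w'(1)] w(1) w'(1) z rel.word_value_append flip: mult.assoc)
  next
    case w': (two u' z' v' z'' t')
    then show ?thesis
      using arg_cong[OF m, of Z_part] w
      by (simp add: monomial_Y_word_append monomial_Y_word)
  next
    case (three u z v z' t z'' s)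
    then show ?thesis
      using assms(2) by (simp add: row1_Y_word_append row1_Z_Cons row2_Y_word_append row2_Z_Cons
        row3_Y_word_append row3_Z_Cons split: if_splits)
  qed
next
  case w: (two u z1 v z2 t)
  have v: "set v \<subseteq> Y_plus" and r: "row1 w = Z_sign z2 * row3 t"
    using assms(1) w
    by (simp_all add: row1_Y_word_append row1_Z_Cons row2_Y_word_append row2_Z_Cons split: if_splits)
  have m: "monomial True w' = image_mset (Pair True) (mset u) +
      add_mset (True, z1) (image_mset (Pair False) (mset v) +
      add_mset (True, z2) (image_mset (Pair True) (mset t)))"
    using assms(4) w by (simp add: monomial_Y_word_append monomial_Y_word)
  show ?thesis
  proof (cases w' rule: word_cases)
    case zero
    then show ?thesis
      using arg_cong[OF m, of Z_part] w by (simp add: monomial_Y_word)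
  next
    case w': (one u' z' v')
    then show ?thesis
      using arg_cong[OF m, of Z_part] w
      by (simp add: monomial_Y_word_append monomial_Y_word)
  next
    case w': (two u' z1' v' z2' t')
    have r': "row1 w' = Z_sign z2' * row3 t'"
      using assms(2) w'
      by (simp_all add: row1_Y_word_append row1_Z_Cons row2_Y_word_append row2_Z_Cons split: if_splits)
    have m': "image_mset (Pair True) (mset u') +
      add_mset (True, z1') (image_mset (Pair False) (mset v') +
      add_mset (True, z2') (image_mset (Pair True) (mset t'))) = image_mset (Pair True) (mset u) +
      add_mset (True, z1) (image_mset (Pair False) (mset v) +
      add_mset (True, z2) (image_mset (Pair True) (mset t)))"
      using m w' by (simp add: monomial_Y_word_append monomial_Y_word)
    have u: "mset (u @ t) = mset (u' @ t')"
      using arg_cong[OF m', of "Y_part True"] w w' by simp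
    have vv: "mset v = mset v'"
      using arg_cong[OF m', of "Y_part False"] w w' by simp
    have z: "{#z1, z2#} = {#z1', z2'#}"
      using arg_cong[OF m', of "Z_part"] w w' by simp
    \<comment> \<open>The factor \<open>row3 t\<close> in the coefficient cancels against the one
      from \<open>val_two_Z\<close>; only the sign of the second letter of degree one survives, in
      the form that \<open>Z_swap\<close> expects.\<close>
    have reduce: "of_int (Z_sign z2 * row3 t) * val (u @ z1 # v @ z2 # t) =
        (val (u @ t) * (of_int (Z_sign z2) * (gen z1 * val v * gen z2)) :: 'a rel_free)"
      if "is_Z z1" "is_Z z2" "Y_word v" "Y_word t" for u z1 v z2 t
    proof -
      have "of_int (Z_sign z2 * row3 t) * val (u @ z1 # v @ z2 # t) =
        (of_int (Z_sign z2 * (row3 t * row3 t)) :: 'a rel_free) *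
          (val (u @ t) * (gen z1 * val v * gen z2))"
        by (simp only: val_two_Z[OF that] of_int_mult mult.assoc)
      also have "\<dots> = val (u @ t) * (of_int (Z_sign z2) * (gen z1 * val v * gen z2))"
        using that by (simp add: row3_Y_word_square mult_of_int_left_commute[of "val (u @ t)"])
      finally show ?thesis .
    qed
    let ?G = "of_int (Z_sign z2) * (gen z1 * val v * gen z2) :: 'a rel_free"
    have V: "val v = (val v' :: 'a rel_free)"
      using v vv by (rule val_Y_plus_mset_cong)
    \<comment> \<open>Two equal multisets with two elements agree in order or are exchanged; the
      second possibility is \<open>Z_swap\<close>.\<close>
    have "?G = of_int (Z_sign z2') * (gen z1' * val v' * gen z2')"
      using z Z_swap[OF w(2,3) v, where 'a = 'a] by (auto simp: V add_eq_conv_ex)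
    \<comment> \<open>The gathered letters act on \<open>gen z1\<close>, which has degree one, and
      so may be permuted.\<close>
    moreover have "val (u @ t) * ?G = val (u' @ t') * ?G"
    proof -
      have "val (u @ t) * (gen z1 :: 'a rel_free) = val (u' @ t') * gen z1"
        using w by (intro val_mult_degree_1_mset_cong[OF _ u]) (simp_all add: gen_Z_degree)
      moreover have G: "val l * ?G = of_int (Z_sign z2) * (val l * gen z1 * (val v * gen z2))" for l
        by (simp only: mult_of_int_left_commute mult.assoc)
      ultimately show ?thesis
        by (simp only: G)
    qed
    moreover have "of_int (row1 w) * val w = val (u @ t) * ?G"
      unfolding r unfolding w(1) by (rule reduce[OF w(2,3,5,6)])
    moreover have "of_int (row1 w') * val w' =
        val (u' @ t') * (of_int (Z_sign z2') * (gen z1' * val v' * gen z2') :: 'a rel_free)"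
      unfolding r' unfolding w'(1) by (rule reduce[OF w'(2,3,5,6)])
    ultimately show ?thesis
      by simp
  next
    case (three u z v z' t z'' s)
    then show ?thesis
      using assms(2) by (simp add: row1_Y_word_append row1_Z_Cons row2_Y_word_append row2_Z_Cons
        row3_Y_word_append row3_Z_Cons split: if_splits)
  qed
next
  case (three u z v z' t z'' s)
  then show ?thesis
    using assms(1) by (simp add: row1_Y_word_append row1_Z_Cons row2_Y_word_append row2_Z_Cons
      row3_Y_word_append row3_Z_Cons split: if_splits)
qed

text \<open>The mirror situation: the letters before the only \<open>z\<close> are symmetric and
  commute, while those after it include a skew one and are sorted by acting from the right on
  \<open>gen z\<close>.\<close>

lemma val_eq_of_monomial_False:
  assumes "row1 w = 0" "row2 w \<noteq> 0" "row1 w' = 0" "row2 w' \<noteq> 0"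
    and "monomial False w = monomial False w'"
  shows "of_int (row2 w) * val w = (of_int (row2 w') * val w' :: 'a::field_char_0 rel_free)"
proof -
  \<comment> \<open>On words in \<open>Y\<close> the value of \<open>row1\<close> is 1, and from two
    letters of degree one on \<open>row2\<close> is 0, so exactly one such letter remains.\<close>
  have shape: "\<exists>u z v. w = u @ z # v \<and> is_Z z \<and> set u \<subseteq> Y_plus \<and> Y_word v \<and>
      row2 w = Z_sign z * row3 v" if "row1 w = 0" "row2 w \<noteq> 0" for w
    using that
    by (cases w rule: word_cases)
      (auto simp: row1_Y_word row2_Y_word_append row2_Z_Cons row3_Y_word_append row3_Z_Cons
        split: if_splits)
  obtain u z v where w: "w = u @ z # v" "is_Z z" "set u \<subseteq> Y_plus" "Y_word v"
      "row2 w = Z_sign z * row3 v"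
    using shape[OF assms(1,2)] by blast
  obtain u' z' v' where w': "w' = u' @ z' # v'" "is_Z z'" "set u' \<subseteq> Y_plus" "Y_word v'"
      "row2 w' = Z_sign z' * row3 v'"
    using shape[OF assms(3,4)] by blast
  have Y: "Y_word u" "Y_word u'"
    using w(3) w'(3) by (simp_all add: Y_plus_imp_Y_word)
  have m: "image_mset (Pair False) (mset u) + add_mset (True, z) (image_mset (Pair True) (mset v)) =
      image_mset (Pair False) (mset u') + add_mset (True, z') (image_mset (Pair True) (mset v'))"
    using assms(5) w w' Y by (simp add: monomial_Y_word_append monomial_Y_word)
  have u: "mset u = mset u'"
    using arg_cong[OF m, of "Y_part False"] w w' Y by simp
  have v: "mset v = mset v'"
    using arg_cong[OF m, of "Y_part True"] w w' Y by simp
  have z: "z = z'"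
    using arg_cong[OF m, of "Z_part"] w w' Y by simp
  have "gen z * val v = (gen z * val v' :: 'a rel_free)"
    using degree_1_mult_val_mset_cong[OF w(4) v] w(2) gen_Z_degree by blast
  moreover have "val u = (val u' :: 'a rel_free)"
    using w(3) u by (rule val_Y_plus_mset_cong)
  moreover have "row2 w = row2 w'"
    using w w' z row3_mset_cong[OF w(4) v] by simp
  ultimately show ?thesis
    by (simp add: w(1) w'(1) z rel.word_value_append)
qed

text \<open>Invisibility in both rows forces a skew letter on each side of a single \<open>z\<close>
  (\<open>rel_identity8\<close>), a skew letter between two letters of degree one
  (\<open>rel_identity9\<close>), or at least three such letters
  (\<open>rel_identity2\<close>).\<close>

lemma val_eq_0:
  assumes "\<not> Y_word w" "row1 w = 0" "row2 w = 0"
  shows "val w = (0 :: 'a::field_char_0 rel_free)"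
proof (cases w rule: word_cases)
  case zero
  then show ?thesis using assms(1) by simp
next
  case (one u z v)
  have "\<not> set v \<subseteq> Y_plus"
    using assms(2) one by (auto simp: row1_Y_word_append row1_Z_Cons row2_Y_word)
  then obtain p' n' q' where v: "v = p' @ Y Skew n' # q'" "Y_word p'" "Y_word q'"
    using not_Y_plus_split one by metis
  \<comment> \<open>Since this factor is a sign, the vanishing of \<open>row2 w\<close> must come
    from a skew letter in \<open>u\<close>.\<close>
  have "Z_sign z * row3 v \<noteq> 0"
    using one Z_sign_square[of z] row3_Y_word_square[of v] by auto
  then have "\<not> set u \<subseteq> Y_plus"
    using assms(3) one by (auto simp: row2_Y_word_append row2_Z_Cons)
  then obtain p n q where u: "u = p @ Y Skew n # q" "Y_word p" "Y_word q"
    using not_Y_plus_split one by metis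
  have "val q * gen z * val p' \<in> (rel_degree 1 :: 'a rel_free set)"
    using one u v by (simp add: rel_degree_mult_0 val_Y_word_degree gen_Z_degree)
  from rel_identity8[OF gen_Y this gen_Y, of n n']
  have "val p * (gen (Y Skew n) * (val q * gen z * val p') * gen (Y Skew n')) * val q' = (0 :: 'a rel_free)"
    by simp
  then show ?thesis
    by (simp add: one u v rel.word_value_append mult.assoc)
next
  case (two u z v z' t)
  have "Z_sign z' * row3 t \<noteq> 0"
    using two Z_sign_square[of z'] row3_Y_word_square[of t] by auto
  then have "\<not> set v \<subseteq> Y_plus"
    using assms(2) two
    by (auto simp: row1_Y_word_append row1_Z_Cons row2_Y_word_append row2_Z_Cons)
  then obtain p n q where v: "v = p @ Y Skew n # q" "Y_word p" "Y_word q"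
    using not_Y_plus_split two by metis
  have "gen z * val p \<in> (rel_degree 1 :: 'a rel_free set)"
    "val q * gen z' \<in> (rel_degree 1 :: 'a rel_free set)"
    using two v by (simp_all add: rel_degree_mult_0 val_Y_word_degree gen_Z_degree)
  from rel_identity9[OF this(1) gen_Y this(2), of n]
  have "val u * (gen z * val p * gen (Y Skew n) * (val q * gen z')) * val t = (0 :: 'a rel_free)"
    by simp
  then show ?thesis
    by (simp add: two v rel.word_value_append mult.assoc)
next
  case (three u z v z' t z'' s)
  have "gen z * val v \<in> (rel_degree 1 :: 'a rel_free set)"
    "gen z' * val t \<in> (rel_degree 1 :: 'a rel_free set)"
    "gen z'' \<in> (rel_degree 1 :: 'a rel_free set)"
    using three by (simp_all add: rel_degree_mult_0 val_Y_word_degree gen_Z_degree)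
  from rel_identity2[OF this]
  have "val u * (gen z * val v * (gen z' * val t) * gen z'') * val s = (0 :: 'a rel_free)"
    by simp
  then show ?thesis
    by (simp add: three rel.word_value_append mult.assoc)
qed

section \<open>Words in letters of degree zero\<close>

text \<open>Moving a symmetric letter to the left across skew letters produces one commutator with each of
  them, with alternating signs once the commutators are brought to normal form. So \<open>swaps x w\<close>
  counts the occurrences of \<open>x\<close> that have an odd number of skew letters to their left.\<close>

fun swaps :: "indet \<Rightarrow> indet list \<Rightarrow> int" where
  "swaps x [] = 0"
| "swaps x (Y Sym n # w) = swaps x w"
| "swaps x (Y Skew n # w) = int (count (mset w) x) - swaps x w"
| "swaps x (Z s n # w) = swaps x w"

text \<open>An occurrence of \<open>Y Sym i\<close> contributes the sign of its suffix, which is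
  \<open>row3 w\<close> times the sign of its prefix. The prefix sign is 1 minus twice the parity of
  the skew letters to the left, and summing that parity gives \<open>swaps\<close>.\<close>

lemma corner_eq_swaps:
  "Y_word w \<Longrightarrow> corner i w = row3 w * (int (count (mset w) (Y Sym i)) - 2 * swaps (Y Sym i) w)"
  by (induction "Y Sym i" w rule: swaps.induct) (auto simp: algebra_simps)

text \<open>Meant for words of skew letters, the first of which is paired with \<open>x\<close>.
  Without skew letters there is no commutator, hence the value 0.\<close>

fun first_commutator :: "indet \<Rightarrow> indet list \<Rightarrow> 'a::field_char_0 rel_free" where
  "first_commutator x [] = 0"
| "first_commutator x (y # w) = (gen y * gen x - gen x * gen y) * val w"

text \<open>The outer skew letters of \<open>b * a * c\<close> may be exchanged and \<open>b\<close>
  commutes with \<open>c\<close>. So it is immaterial which skew letter enters the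
  commutator.\<close>

lemma commutator_exchange:
  assumes "a \<in> Yp" "b \<in> Ym" "c \<in> Ym"
  shows "(b * a - a * b) * c = (c * a - a * c) * b"
proof -
  have "b * a * c = c * a * b"
    using assms by (intro rel_identity1[of 0 Skew _ _ _ 0 Sym]) simp_all
  moreover have "b * c = c * b"
    using assms(2,3) by (rule rel_identity3)
  ultimately show ?thesis
    by (simp add: left_diff_distrib mult.assoc)
qed

lemma first_commutator_mset_cong:
  assumes "x \<in> Y_plus" "set w \<subseteq> Y_minus" "mset w = mset w'"
  shows "first_commutator x w = (first_commutator x w' :: 'a::field_char_0 rel_free)"
proof (cases w)
  case (Cons y v)
  have "y \<in> set w'"
    using assms(3) Cons by (metis list.set_intros(1) set_mset_mset)
  then obtain p q where w': "w' = p @ y # q"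
    by (auto dest: split_list)
  have vpq: "mset v = mset (p @ q)"
    using assms(3) by (simp add: Cons w')
  have vv: "val v = (val (p @ q) :: 'a rel_free)"
    using assms(2) Cons vpq by (intro val_Y_minus_mset_cong) auto
  show ?thesis
  proof (cases p)
    case Nil
    then show ?thesis
      using vv by (simp add: Cons w')
  next
    case p: (Cons y' p')
    have sets: "y \<in> Y_minus" "y' \<in> Y_minus" "set (p' @ y # q) \<subseteq> Y_minus"
      using assms(2) mset_eq_setD[OF assms(3)] by (auto simp: Cons w' p)
    have "first_commutator x w' = ((gen y' * gen x - gen x * gen y') * val (p' @ y # q) :: 'a rel_free)"
      by (simp add: w' p)
    also have "val (p' @ y # q) = (val (y # p' @ q) :: 'a rel_free)"
      using sets by (intro val_Y_minus_mset_cong) auto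
    also have "(gen y' * gen x - gen x * gen y') * val (y # p' @ q) =
        ((gen y' * gen x - gen x * gen y') * gen y) * (val (p' @ q) :: 'a rel_free)"
      by (simp add: mult.assoc)
    also have "(gen y' * gen x - gen x * gen y') * gen y =
        ((gen y * gen x - gen x * gen y) * gen y' :: 'a rel_free)"
      using assms(1) sets by (intro commutator_exchange) (auto simp: Y_plus_def Y_minus_def gen_Y)
    also have "\<dots> * val (p' @ q) = (gen y * gen x - gen x * gen y) * val v"
      unfolding vv p by (simp add: mult.assoc)
    finally show ?thesis
      by (simp add: Cons)
  qed
qed (use assms in simp)

text \<open>The commutator of a skew and a symmetric element of degree zero is itself symmetric of
  degree zero, and such elements commute.\<close>

lemma val_Y_plus_commutator_commute:
  assumes "set u \<subseteq> Y_plus" "a \<in> Yp" "b \<in> Ym"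
  shows "val u * (b * a - a * b) = (b * a - a * b) * val u"
proof -
  have "rel_star (b * a - a * b) = b * a - a * b"
    using assms(2,3)
    by (simp add: rel_star_diff rel_star_mult rel_component_def rel_const_one rel_const_uminus_one)
  then have "b * a - a * b \<in> Yp"
    using assms(2,3)
    by (simp add: rel_component_def rel_const_one rel_degree_diff rel_degree_mult_0)
  with val_Y_plus_in_Yp[OF assms(1)] show ?thesis
    by (rule rel_identity3)
qed

lemma mult_of_nat_left_commute: "y * (of_nat n * z) = of_nat n * (y * z)"
  for y z :: "'b::semiring_1"
  by (simp flip: mult.assoc mult_of_nat_commute)

text \<open>Commutation with \<open>gen y\<close> is a derivation: each occurrence in
  \<open>u\<close> yields one commutator, and this moves to the right end because it commutes with
  symmetric letters. No nested commutators arise.\<close>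

lemma skew_mult_val_Y_plus:
  assumes S: "finite S" "set u \<subseteq> S" "S \<subseteq> Y_plus" and y: "y \<in> Y_minus"
  shows "gen y * val u = (val u * gen y +
    (\<Sum>x\<in>S. of_nat (count (mset u) x) * (val (remove1 x u) * (gen y * gen x - gen x * gen y)))
    :: 'a::field_char_0 rel_free)"
  using S(2)
proof (induction u)
  case (Cons a u)
  let ?c = "\<lambda>x. gen y * gen x - gen x * gen y :: 'a rel_free"
  let ?t = "\<lambda>u x. of_nat (count (mset u) x) * (val (remove1 x u) * ?c x) :: 'a rel_free"
  have a: "a \<in> S" "a \<in> Y_plus" and u: "set u \<subseteq> Y_plus"
    using Cons.prems S(3) by auto
  have "gen a * ?t u x = of_nat (count (mset u) x) * (val (remove1 x (a # u)) * ?c x)" for x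
  proof (cases "x \<in> set u")
    case True
    have eq: "val (a # remove1 x u) = (val (remove1 x (a # u)) :: 'a rel_free)"
    proof (rule val_Y_plus_mset_cong)
      show "set (a # remove1 x u) \<subseteq> Y_plus"
        using a u set_remove1_subset[of x u] by auto
      show "mset (a # remove1 x u) = mset (remove1 x (a # u))"
        using True by (cases "x = a") simp_all
    qed
    then show ?thesis
      by (simp only: eq[symmetric] rel.word_value_Cons mult.assoc
          mult_of_nat_left_commute[of "gen a"])
  next
    \<comment> \<open>For \<open>x = a\<close> the two words would differ here, but the coefficient
      is zero.\<close>
    case False
    then have "count (mset u) x = 0"
      by (simp add: count_mset_0_iff)
    then show ?thesis
      by (simp only: of_nat_0 mult_zero_left mult_zero_right)
  qed
  then have 1: "gen a * (\<Sum>x\<in>S. ?t u x) =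
      (\<Sum>x\<in>S. of_nat (count (mset u) x) * (val (remove1 x (a # u)) * ?c x))"
    by (simp add: sum_distrib_left)
  have "?t (a # u) x = of_nat (count (mset u) x) * (val (remove1 x (a # u)) * ?c x) +
      (if x = a then val u * ?c a else 0)" for x
    by (simp add: distrib_right)
  then have 2: "(\<Sum>x\<in>S. ?t (a # u) x) =
      (\<Sum>x\<in>S. of_nat (count (mset u) x) * (val (remove1 x (a # u)) * ?c x)) + val u * ?c a"
    using S(1) a(1) by (simp add: sum.distrib)
  have c: "val u * ?c a = ?c a * val u"
    using u a(2) y by (intro val_Y_plus_commutator_commute) (auto simp: Y_plus_def Y_minus_def gen_Y)
  have "gen y * val (a # u) = gen a * (gen y * val u) + ?c a * (val u :: 'a rel_free)"
    by (simp add: algebra_simps)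
  also have "gen a * (gen y * val u) = val (a # u) * gen y + gen a * (\<Sum>x\<in>S. ?t u x)"
    using Cons by (simp add: distrib_left mult.assoc)
  finally show ?case
    unfolding 1 2 c by (simp add: add.assoc)
qed simp

text \<open>The new letter anticommutes with the commutator already present, which gives the sign;
  what it leaves behind while crossing \<open>u\<close> is a product of two commutators and
  vanishes; finally \<open>commutator_exchange\<close> brings it to the first place.\<close>

lemma skew_mult_val_first_commutator:
  assumes "set u \<subseteq> Y_plus" "x \<in> Y_plus" "y \<in> Y_minus" "set v \<subseteq> Y_minus" "v \<noteq> []"
  shows "gen y * (val u * first_commutator x v) =
    - (val u * first_commutator x (y # v) :: 'a::field_char_0 rel_free)"
proof -
  obtain y' v' where v: "v = y' # v'"
    using assms(5) by (cases v) auto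
  have Ys: "(gen x :: 'a rel_free) \<in> Yp" "(gen y :: 'a rel_free) \<in> Ym" "(gen y' :: 'a rel_free) \<in> Ym"
    using assms by (auto simp: v Y_plus_def Y_minus_def gen_Y)
  let ?c = "gen y' * gen x - gen x * gen y' :: 'a rel_free"
  have kill: "?c * (gen y * gen a - gen a * gen y) = 0" for a
  proof -
    have "(gen x * gen y' - gen y' * gen x) * (gen y * gen a - gen a * gen y :: 'a rel_free) = 0"
      using Ys(1,3) gen_in_component gen_in_component by (rule rel_identity4_homogeneous)
    then show ?thesis
      by (simp add: algebra_simps)
  qed
  have comm: "val l * ?c = ?c * val l" if "set l \<subseteq> Y_plus" for l
    using that Ys(1,3) by (rule val_Y_plus_commutator_commute)
  \<comment> \<open>To the right of the commutator \<open>?c\<close>, the letter \<open>y\<close>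
    may pass symmetric letters freely, since \<open>kill\<close> removes each correction
    term.\<close>
  have shift: "?c * (gen y * val l) = ?c * (val l * gen y)" if "set l \<subseteq> Y_plus" for l
    using that
  proof (induction l)
    case (Cons a l)
    have ca: "gen a * ?c = ?c * gen a"
      using comm[of "[a]"] Cons.prems by simp
    have "?c * (gen y * val (a # l)) - ?c * gen a * (gen y * val l) =
        ?c * (gen y * gen a - gen a * gen y) * val l"
      by (simp only: rel.word_value_Cons left_diff_distrib right_diff_distrib mult.assoc)
    also have "\<dots> = 0"
      by (simp only: kill mult_zero_left)
    finally have "?c * (gen y * val (a # l)) = gen a * (?c * (gen y * val l))"
      by (simp only: right_minus_eq ca[symmetric] mult.assoc)
    also have "\<dots> = gen a * (?c * (val l * gen y))"
      using Cons by simp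
    also have "\<dots> = ?c * (val (a # l) * gen y)"
      by (simp only: mult.assoc[symmetric] ca rel.word_value_Cons)
    finally show ?case .
  qed simp
  have anti: "?c * gen y = - (gen y * ?c)"
    using rel_identity7[OF Ys(1,3,2)] by (simp add: algebra_simps)
  have "gen y * (val u * ?c) = (gen y * ?c) * val u"
    by (simp only: comm[OF assms(1)] mult.assoc)
  also have "\<dots> = - (?c * (gen y * val u))"
    by (simp only: mult.assoc[symmetric] anti mult_minus_left minus_minus)
  also have "\<dots> = - (val u * (?c * gen y))"
    unfolding shift[OF assms(1)] by (simp only: comm[OF assms(1)] mult.assoc[symmetric])
  also have "?c * gen y = (gen y * gen x - gen x * gen y) * gen y'"
    using Ys(1,3,2) by (rule commutator_exchange)
  finally have "gen y * (val u * ?c) * val v' =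
      - (val u * ((gen y * gen x - gen x * gen y) * gen y')) * val v'"
    by (rule arg_cong)
  then show ?thesis
    by (simp only: v first_commutator.simps rel.word_value_Cons mult.assoc mult_minus_left)
qed

lemma swaps_eq_0:
  assumes "Y_word w" "x \<notin> set w \<or> set w \<subseteq> Y_plus"
  shows "swaps x w = 0"
  using assms
  by (induction x w rule: swaps.induct) (auto simp: Y_plus_def count_mset_0_iff)

text \<open>Induction from the right end of the word, following the recursion of
  \<open>swaps\<close>. A symmetric letter joins the sorted part; a skew one creates a commutator
  for every symmetric letter it crosses and reverses the sign of the existing commutator terms.
  \<open>S\<close> may exceed the letters of \<open>w\<close>, so that it can stay fixed when
  passing to the tail.\<close>

lemma val_Y_word_expansion:
  assumes S: "finite S" "S \<subseteq> Y_plus" and w: "Y_word w" "set w \<inter> Y_plus \<subseteq> S"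
  shows "val w = (val (filter (\<lambda>x. x \<in> Y_plus) w) * val (filter (\<lambda>x. x \<in> Y_minus) w) +
    (\<Sum>x\<in>S. of_int (swaps x w) * (val (remove1 x (filter (\<lambda>x. x \<in> Y_plus) w)) *
      first_commutator x (filter (\<lambda>x. x \<in> Y_minus) w))) :: 'a::field_char_0 rel_free)"
  using w
proof (induction w)
  case (Cons a w)
  let ?A = "filter (\<lambda>x. x \<in> Y_plus) w" and ?D = "filter (\<lambda>x. x \<in> Y_minus) w"
  let ?t = "\<lambda>A D x. val (remove1 x A) * first_commutator x D :: 'a rel_free"
  have IH: "val w = val ?A * val ?D + (\<Sum>x\<in>S. of_int (swaps x w) * ?t ?A ?D x)"
    using Cons.prems by (intro Cons.IH) auto
  have AS: "set ?A \<subseteq> S" "set ?A \<subseteq> Y_plus" and w: "Y_word w"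
    using Cons.prems by auto
  consider (plus) n where "a = Y Sym n" | (minus) n where "a = Y Skew n"
    using Cons.prems(1) by (cases a; cases "indet_symmetry a") auto
  then show ?case
  proof cases
    case plus
    then have a: "a \<in> Y_plus" "a \<notin> Y_minus"
      by (auto simp: Y_plus_def Y_minus_def)
    have "gen a * (of_int (swaps x w) * ?t ?A ?D x) = of_int (swaps x w) * ?t (a # ?A) ?D x"
      if x: "x \<in> S" for x
    proof (cases "x \<in> set ?A")
      case True
      have eq: "val (a # remove1 x ?A) = (val (remove1 x (a # ?A)) :: 'a rel_free)"
      proof (rule val_Y_plus_mset_cong)
        show "set (a # remove1 x ?A) \<subseteq> Y_plus"
          using a AS set_remove1_subset[of x ?A] by auto
        show "mset (a # remove1 x ?A) = mset (remove1 x (a # ?A))"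
          using True by (cases "x = a") simp_all
      qed
      then show ?thesis
        by (simp only: eq[symmetric] rel.word_value_Cons mult.assoc
            mult_of_int_left_commute[of "gen a"])
    next
      \<comment> \<open>If \<open>x = a\<close>, removing \<open>x\<close> would take away the new
        letter itself; but \<open>x\<close> does not occur in \<open>w\<close>, so the coefficient
        is zero.\<close>
      case False
      then have "swaps x w = 0"
        using x S(2) w by (intro swaps_eq_0) auto
      then show ?thesis
        by (simp only: of_int_0 mult_zero_left mult_zero_right)
    qed
    then have "gen a * (\<Sum>x\<in>S. of_int (swaps x w) * ?t ?A ?D x) =
        (\<Sum>x\<in>S. of_int (swaps x w) * ?t (a # ?A) ?D x)"
      by (simp add: sum_distrib_left)
    moreover have "swaps x (a # w) = swaps x w" for x
      by (simp add: plus)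
    ultimately show ?thesis
      using a by (simp add: IH distrib_left mult.assoc)
  next
    case minus
    then have a: "a \<notin> Y_plus" "a \<in> Y_minus"
      by (auto simp: Y_plus_def Y_minus_def)
    have 1: "gen a * (of_int (swaps x w) * ?t ?A ?D x) = - (of_int (swaps x w) * ?t ?A (a # ?D) x)"
      if x: "x \<in> S" for x
    proof (cases "?D = []")
      \<comment> \<open>Without a skew letter in \<open>w\<close> the sign rule fails, as the right
        side already contains a commutator with \<open>a\<close>; but then \<open>swaps x w\<close>
        is zero.\<close>
      case True
      then have "set w \<subseteq> Y_plus"
        using w by (auto simp: Y_word_iff filter_empty_conv)
      then have "swaps x w = 0"
        using w by (intro swaps_eq_0) auto
      then show ?thesis
        by (simp only: of_int_0 mult_zero_left mult_zero_right minus_zero)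
    next
      case False
      have "gen a * ?t ?A ?D x = - ?t ?A (a # ?D) x"
        using AS(2) x S(2) a(2) False set_remove1_subset[of x ?A]
        by (intro skew_mult_val_first_commutator) auto
      then show ?thesis
        by (simp only: mult_of_int_left_commute[of "gen a"] mult_minus_right)
    qed
    have 2: "gen a * (val ?A * val ?D) = val ?A * val (a # ?D) +
        (\<Sum>x\<in>S. of_nat (count (mset ?A) x) * ?t ?A (a # ?D) x)"
      using skew_mult_val_Y_plus[OF S(1) AS(1) S(2) a(2), where 'a = 'a]
      by (simp only: mult.assoc[symmetric] distrib_right sum_distrib_right)
        (simp only: mult.assoc first_commutator.simps rel.word_value_Cons)
    have 3: "of_nat (count (mset ?A) x) * ?t ?A (a # ?D) x - of_int (swaps x w) * ?t ?A (a # ?D) x =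
        of_int (swaps x (a # w)) * ?t ?A (a # ?D) x" if "x \<in> S" for x
    proof -
      have "count (mset ?A) x = count (mset w) x"
        using that S(2) by (auto simp: mset_filter)
      then show ?thesis
        by (simp only: minus swaps.simps of_int_diff of_int_of_nat_eq left_diff_distrib)
    qed
    have "val (a # w) = gen a * (val ?A * val ?D) +
        (\<Sum>x\<in>S. gen a * (of_int (swaps x w) * ?t ?A ?D x))"
      by (simp only: rel.word_value_Cons IH distrib_left sum_distrib_left)
    also have "\<dots> = val ?A * val (a # ?D) +
        ((\<Sum>x\<in>S. of_nat (count (mset ?A) x) * ?t ?A (a # ?D) x) -
         (\<Sum>x\<in>S. of_int (swaps x w) * ?t ?A (a # ?D) x))"
      by (simp only: 2 1 sum_negf add_diff_eq add_uminus_conv_diff cong: sum.cong)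
    also have "\<dots> = val ?A * val (a # ?D) + (\<Sum>x\<in>S. of_int (swaps x (a # w)) * ?t ?A (a # ?D) x)"
      by (simp only: sum_subtractf[symmetric] 3 cong: sum.cong)
    finally show ?thesis
      using a by simp
  qed
qed simp

section \<open>Identities are consequences of the basis\<close>

lemma rel_const_sum: "rel_const (sum g K) = (\<Sum>k\<in>K. rel_const (g k))"
  by (induction K rule: infinite_finite_induct) (simp_all add: rel_const_add rel.scal_zero)

lemma rel_const_uminus: "rel_const (- c) = - rel_const c"
  using rel_const_mult[of "- 1" c] by (simp add: rel_const_uminus_one)

lemma rel_const_of_nat: "rel_const (of_nat n) = of_nat n"
  by (induction n) (simp_all add: rel_const_add rel_const_one rel.scal_zero)

lemma rel_const_of_int: "rel_const (of_int n) = of_int n"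
  by (cases n) (simp_all add: rel_const_of_nat rel_const_uminus rel_const_one rel_const_add
      del: of_nat_Suc)

text \<open>Within a fibre of \<open>M\<close> the signed values coincide in the quotient, so they
  factor out and leave the signed sum of coefficients. As the sign squares to 1, each value is
  recovered from its signed value.\<close>

lemma fibrewise_zero_sum:
  fixes v :: "'k \<Rightarrow> 'a::field_char_0 rel_free"
  assumes K: "finite K"
    and v: "\<And>k l. k \<in> K \<Longrightarrow> l \<in> K \<Longrightarrow> M k = M l \<Longrightarrow> of_int (s k) * v k = of_int (s l) * v l"
    and s: "\<And>k. k \<in> K \<Longrightarrow> s k * s k = 1"
    and 0: "\<And>m. (\<Sum>k\<in>{k\<in>K. M k = m}. c k * of_int (s k)) = 0"
  shows "(\<Sum>k\<in>K. rel_const (c k) * v k) = 0"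
proof -
  have "(\<Sum>k\<in>{k\<in>K. M k = m}. rel_const (c k) * v k) = 0" if m: "m \<in> M ` K" for m
  proof -
    obtain l where l: "l \<in> K" "M l = m"
      using m by blast
    have "rel_const (c k) * v k = rel_const (c k * of_int (s k)) * (of_int (s l) * v l)"
      if "k \<in> {k\<in>K. M k = m}" for k
    proof -
      have "v k = of_int (s k * s k) * v k"
        using s that by simp
      also have "\<dots> = of_int (s k) * (of_int (s l) * v l)"
        using v[of k l] that l by (simp add: mult.assoc)
      finally have "rel_const (c k) * v k = rel_const (c k) * (of_int (s k) * (of_int (s l) * v l))"
        by (rule arg_cong)
      then show ?thesis
        by (simp only: rel_const_mult rel_const_of_int mult.assoc)
    qed
    then have "(\<Sum>k\<in>{k\<in>K. M k = m}. rel_const (c k) * v k) =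
        (\<Sum>k\<in>{k\<in>K. M k = m}. rel_const (c k * of_int (s k)) * (of_int (s l) * v l))"
      by (rule sum.cong[OF refl])
    also have "\<dots> = rel_const (\<Sum>k\<in>{k\<in>K. M k = m}. c k * of_int (s k)) * (of_int (s l) * v l)"
      by (simp only: rel_const_sum sum_distrib_right)
    finally show ?thesis
      by (simp only: 0 rel.scal_zero mult_zero_left)
  qed
  then show ?thesis
    by (simp only: sum.image_gen[OF K, of _ M] sum.neutral_const cong: sum.cong)
qed

text \<open>All words of the same content expand in the same elements \<open>P\<close> and
  \<open>Q x\<close>. Their coefficients are killed separately: that of \<open>P\<close> by the
  (1,1) entry, that of \<open>Q x\<close> by the corner entry for the letter
  \<open>x\<close>.\<close>

lemma Y_word_sum_zero:
  assumes f: "f \<in> UT3_identities"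
  shows "(\<Sum>w\<in>{w\<in>Poly_Mapping.keys f. Y_word w}.
    rel_const (Poly_Mapping.lookup f w) * val w) = (0 :: 'a::field_char_0 rel_free)"
proof -
  let ?K = "{w\<in>Poly_Mapping.keys f. Y_word w}"
  let ?f = "Poly_Mapping.lookup f"
  have K: "finite ?K" by simp
  have "(\<Sum>w\<in>{w\<in>?K. mset w = m}. rel_const (?f w) * val w) = (0 :: 'a rel_free)"
    if m: "m \<in> mset ` ?K" for m
  proof -
    obtain w0 where w0: "w0 \<in> ?K" "mset w0 = m"
      using m by blast
    define S where "S = set w0 \<inter> Y_plus"
    have S: "finite S" "S \<subseteq> Y_plus"
      by (simp_all add: S_def)
    let ?A = "filter (\<lambda>x. x \<in> Y_plus) w0" and ?D = "filter (\<lambda>x. x \<in> Y_minus) w0"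
    define P :: "'a rel_free" where "P = val ?A * val ?D"
    define Q :: "indet \<Rightarrow> 'a rel_free" where
      "Q = (\<lambda>x. val (remove1 x ?A) * first_commutator x ?D)"
    have expand: "val w = P + (\<Sum>x\<in>S. of_int (swaps x w) * Q x)" if w: "w \<in> {w\<in>?K. mset w = m}" for w
    proof -
      have mw: "mset w = mset w0" using w w0 by simp
      let ?A' = "filter (\<lambda>x. x \<in> Y_plus) w" and ?D' = "filter (\<lambda>x. x \<in> Y_minus) w"
      have mA: "mset ?A' = mset ?A" and mD: "mset ?D' = mset ?D"
        using mw by (simp_all add: mset_filter)
      have "val w = val ?A' * val ?D' +
          (\<Sum>x\<in>S. of_int (swaps x w) * (val (remove1 x ?A') * first_commutator x ?D') :: 'a rel_free)"
        using w S mset_eq_setD[OF mw] by (intro val_Y_word_expansion) (auto simp: S_def)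
      moreover have "val ?A' = (val ?A :: 'a rel_free)"
        using mA by (intro val_Y_plus_mset_cong) auto
      moreover have "val ?D' = (val ?D :: 'a rel_free)"
        using mD by (intro val_Y_minus_mset_cong) auto
      moreover have "val (remove1 x ?A') = (val (remove1 x ?A) :: 'a rel_free)" for x
        using mA set_remove1_subset[of x ?A'] by (intro val_Y_plus_mset_cong) auto
      moreover have "first_commutator x ?D' = (first_commutator x ?D :: 'a rel_free)" if "x \<in> S" for x
        using mD that S by (intro first_commutator_mset_cong) auto
      ultimately show ?thesis
        by (simp add: P_def Q_def cong: sum.cong)
    qed
    have sum_f: "(\<Sum>w\<in>{w\<in>?K. mset w = m}. ?f w) = 0"
      by (rule identity_Y_words(1)[OF f])
    \<comment> \<open>By \<open>corner_eq_swaps\<close> the corner relation combines the plain sum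
      of coefficients, already zero, with -2 times the sum sought; 2 and the common sign
      \<open>row3 w0\<close> are invertible.\<close>
    have sum_swaps: "(\<Sum>w\<in>{w\<in>?K. mset w = m}. ?f w * of_int (swaps x w)) = 0" if x: "x \<in> S" for x
    proof -
      obtain i where i: "x = Y Sym i"
        using x S by (auto simp: Y_plus_def)
      have c: "of_int (corner i w) = (of_int (row3 w0) :: 'a) * (of_nat (count m x) - 2 * of_int (swaps x w))"
        if "w \<in> {w\<in>?K. mset w = m}" for w
        using that w0 row3_mset_cong[of w w0] by (simp add: corner_eq_swaps i)
      have "0 = (\<Sum>w\<in>{w\<in>?K. mset w = m}. ?f w * of_int (corner i w))"
        by (rule identity_Y_words(2)[OF f, symmetric])
      also have "\<dots> = (\<Sum>w\<in>{w\<in>?K. mset w = m}.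
          ?f w * (of_int (row3 w0) * (of_nat (count m x) - 2 * of_int (swaps x w))))"
        by (rule sum.cong[OF refl]) (simp only: c)
      also have "\<dots> = of_int (row3 w0) * (of_nat (count m x) * (\<Sum>w\<in>{w\<in>?K. mset w = m}. ?f w) -
          2 * (\<Sum>w\<in>{w\<in>?K. mset w = m}. ?f w * of_int (swaps x w)))"
        by (simp add: sum_distrib_left sum_subtractf algebra_simps)
      finally have "of_int (row3 w0) * (\<Sum>w\<in>{w\<in>?K. mset w = m}. ?f w * of_int (swaps x w)) = 0"
        unfolding sum_f by simp
      moreover have "row3 w0 \<noteq> 0"
        using row3_Y_word_square[of w0] w0 by auto
      ultimately show ?thesis
        by simp
    qed
    have "(\<Sum>w\<in>{w\<in>?K. mset w = m}. rel_const (?f w) * val w) =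
        (\<Sum>w\<in>{w\<in>?K. mset w = m}. rel_const (?f w) * P +
          (\<Sum>x\<in>S. rel_const (?f w * of_int (swaps x w)) * Q x))"
      by (rule sum.cong[OF refl])
        (simp only: expand distrib_left sum_distrib_left rel_const_mult rel_const_of_int mult.assoc)
    also have "\<dots> = rel_const (\<Sum>w\<in>{w\<in>?K. mset w = m}. ?f w) * P +
        (\<Sum>x\<in>S. rel_const (\<Sum>w\<in>{w\<in>?K. mset w = m}. ?f w * of_int (swaps x w)) * Q x)"
      by (simp only: sum.distrib rel_const_sum sum_distrib_right) (simp only: sum.swap[of _ S])
    also have "(\<Sum>x\<in>S. rel_const (\<Sum>w\<in>{w\<in>?K. mset w = m}. ?f w * of_int (swaps x w)) * Q x) = 0"
      by (intro sum.neutral ballI) (simp only: sum_swaps rel.scal_zero mult_zero_left)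
    also have "rel_const (\<Sum>w\<in>{w\<in>?K. mset w = m}. ?f w) * P + 0 = 0"
      by (simp only: sum_f rel.scal_zero mult_zero_left add_0)
    finally show ?thesis .
  qed
  then show ?thesis
    by (simp only: sum.image_gen[OF K, of _ mset] sum.neutral_const cong: sum.cong)
qed

text \<open>Whether a word has letters of degree one depends on its monomial only, so excluding the
  words in \<open>Y\<close> discards whole fibres.\<close>

lemma Y_word_iff_Z_part_monomial: "Y_word w \<longleftrightarrow> Z_part (monomial p w) = {#}"
  by (induction w arbitrary: p) (auto simp: Z_part_def)

lemma row1_sum_zero:
  assumes f: "f \<in> UT3_identities"
  shows "(\<Sum>w\<in>{w\<in>Poly_Mapping.keys f. \<not> Y_word w \<and> row1 w \<noteq> 0}.
    rel_const (Poly_Mapping.lookup f w) * val w) = (0 :: 'a::field_char_0 rel_free)"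
proof (rule fibrewise_zero_sum[where M = "monomial True" and s = row1])
  let ?K = "{w\<in>Poly_Mapping.keys f. \<not> Y_word w \<and> row1 w \<noteq> 0}"
  fix m
  show "(\<Sum>w\<in>{w\<in>?K. monomial True w = m}. Poly_Mapping.lookup f w * of_int (row1 w)) = 0"
  proof (cases "Z_part m = {#}")
    case True
    then have "{w\<in>?K. monomial True w = m} = {}"
      using Y_word_iff_Z_part_monomial by auto
    then show ?thesis
      by (simp only: sum.empty)
  next
    case False
    \<comment> \<open>The words of the full fibre that are missing on the left have
      \<open>row1 w = 0\<close> and contribute nothing.\<close>
    have "(\<Sum>w\<in>{w\<in>?K. monomial True w = m}. Poly_Mapping.lookup f w * of_int (row1 w)) =
      (\<Sum>w\<in>{w\<in>Poly_Mapping.keys f. monomial True w = m}. Poly_Mapping.lookup f w * of_int (row1 w))"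
      using False Y_word_iff_Z_part_monomial by (intro sum.mono_neutral_left) auto
    then show ?thesis
      by (simp only: identity_row_sum1[OF f])
  qed
qed (auto intro: val_eq_of_monomial_True row1_square)

text \<open>With row 2 nonzero, skew letters of degree zero can occur only after a letter of degree
  one, where they carry the flag \<open>True\<close>; such an occurrence is exactly what makes row 1
  vanish. So words invisible in row 1 never share a monomial with words visible in both
  rows.\<close>

lemma row1_eq_0_iff_monomial:
  assumes "row2 w \<noteq> 0"
  shows "row1 w = 0 \<longleftrightarrow> (\<exists>n. (True, Y Skew n) \<in># monomial False w)"
proof (cases w rule: word_cases)
  case zero
  then show ?thesis
    by (auto simp: row1_Y_word monomial_Y_word)
next
  case (one u z v)
  have "set v \<subseteq> Y_plus \<longleftrightarrow> (\<nexists>n. Y Skew n \<in> set v)"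
    using one(4) by (auto simp: Y_word_iff Y_minus_def) (auto simp: Y_plus_def)
  then show ?thesis
    using one by (auto simp: row1_Y_word_append row1_Z_Cons row2_Y_word monomial_Y_word_append
        monomial_Y_word)
next
  case (two u z v z' t)
  then show ?thesis
    using assms by (simp add: row2_Y_word_append row2_Z_Cons row3_Y_word_append row3_Z_Cons
        split: if_splits)
next
  case (three u z v z' t z'' s)
  then show ?thesis
    using assms by (simp add: row2_Y_word_append row2_Z_Cons row3_Y_word_append row3_Z_Cons
        split: if_splits)
qed

lemma row2_sum_zero:
  assumes f: "f \<in> UT3_identities"
  shows "(\<Sum>w\<in>{w\<in>Poly_Mapping.keys f. row1 w = 0 \<and> row2 w \<noteq> 0}.
    rel_const (Poly_Mapping.lookup f w) * val w) = (0 :: 'a::field_char_0 rel_free)"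
proof (rule fibrewise_zero_sum[where M = "monomial False" and s = row2])
  let ?K = "{w\<in>Poly_Mapping.keys f. row1 w = 0 \<and> row2 w \<noteq> 0}"
  fix m
  show "(\<Sum>w\<in>{w\<in>?K. monomial False w = m}. Poly_Mapping.lookup f w * of_int (row2 w)) = 0"
  proof (cases "\<exists>n. (True, Y Skew n) \<in># m")
    case False
    then have "{w\<in>?K. monomial False w = m} = {}"
      using row1_eq_0_iff_monomial by auto
    then show ?thesis
      by (simp only: sum.empty)
  next
    case True
    have "(\<Sum>w\<in>{w\<in>?K. monomial False w = m}. Poly_Mapping.lookup f w * of_int (row2 w)) =
      (\<Sum>w\<in>{w\<in>Poly_Mapping.keys f. monomial False w = m}. Poly_Mapping.lookup f w * of_int (row2 w))"
      using True row1_eq_0_iff_monomial by (intro sum.mono_neutral_left) auto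
    then show ?thesis
      by (simp only: identity_row_sum2[OF f])
  qed
qed (auto intro: val_eq_of_monomial_False row2_square)

lemma identities_subset_generated:
  "(UT3_identities :: 'a::field_char_0 free_algebra set) \<subseteq> generated_T_ideal basis_polynomials"
proof
  fix f :: "'a free_algebra"
  assume f: "f \<in> UT3_identities"
  let ?t = "\<lambda>w. rel_const (Poly_Mapping.lookup f w) * val w"
  let ?A = "{w\<in>Poly_Mapping.keys f. Y_word w}"
  let ?B = "{w\<in>Poly_Mapping.keys f. \<not> Y_word w \<and> row1 w \<noteq> 0}"
  let ?C = "{w\<in>Poly_Mapping.keys f. row1 w = 0 \<and> row2 w \<noteq> 0}"
  have "proj f = rel.extension gen f"
    by (rule rel.extension_unique) (simp_all add: proj_add proj_mult rel_const_def)
  also have "\<dots> = sum ?t (Poly_Mapping.keys f)"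
    by (simp add: rel.extension_def)
  \<comment> \<open>A word outside the three sets contains a letter of degree one and is invisible
    in both rows, so \<open>val_eq_0\<close> applies. A word in \<open>Y\<close> has
    \<open>row1\<close> equal to 1, which keeps \<open>?C\<close> disjoint from
    \<open>?A\<close>.\<close>
  also have "\<dots> = sum ?t (?A \<union> ?B \<union> ?C)"
    by (rule sum.mono_neutral_right) (auto simp: val_eq_0)
  also have "\<dots> = sum ?t (?A \<union> ?B) + sum ?t ?C"
    by (rule sum.union_disjoint) (auto simp: row1_Y_word)
  also have "sum ?t (?A \<union> ?B) = sum ?t ?A + sum ?t ?B"
    by (rule sum.union_disjoint) auto
  finally have "proj f = 0"
    by (simp only: Y_word_sum_zero[OF f] row1_sum_zero[OF f] row2_sum_zero[OF f] add_0)
  then show "f \<in> generated_T_ideal basis_polynomials"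
    by (simp add: proj_eq_0_iff)
qed

theorem theorem3p3:
  shows "is_basis_of_UT3_identities (basis_polynomials :: 'a::field_char_0 free_algebra set)"
  unfolding is_basis_of_UT3_identities_def
  using generated_subset_identities identities_subset_generated by (rule subset_antisym)

end
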